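(* Let $M$ be an abelian group and let $T\colon M\to M$ be an automorphism of $M$ such that $1-T\colon M\to M$ is invertible. Let $A(M,T)$ be the associated Alexander quandle. Then the fundamental group $\pi_1(A(M,T),0)$ based at $0\in M$ is isomorphic to $S(M,T)=\operatorname{coker}(1-\tau)$, where $\tau\colon M\otimes M\to M\otimes M$ is given by $\tau(x\otimes y)=Ty\otimes x$.
   Context: The Alexander quandle $A(M,T)$ of an abelian group $M$ with an automorphism $T$ is the set $M$ with the quandle operation $y*x=Ty+x-Tx$. The adjoint group $\operatorname{Adj}(Q)$ of a quandle $Q$ is the abstract group with one generator $e_x$ for each $x\in Q$ and one relation $e_{y*x}=e_x^{-1}e_ye_x$ for each pair $x,y\in Q$. It acts on $Q$ from the right by $p\cdot e_x=p*x$. There is a unique homomorphism $\epsilon\colon\operatorname{Adj}(Q)\to\mathbf{Z}$ with $\epsilon(e_x)=1$ for all $x\in Q$; its kernel is denoted $\operatorname{Adj}(Q)^o$. The fundamental group of $Q$ based at $q\in Q$ is $\pi_1(Q,q)=\{g\in\operatorname{Adj}(Q)^o \mid q\cdot g=q\}$. Tensor products are over $\mathbf{Z}$; the additive map $\tau\colon M\otimes M\to M\otimes M$ is determined by $\tau(x\otimes y)=Ty\otimes x$, and $S(M,T)$ is the abelian group $(M\otimes M)/\operatorname{im}(1-\tau)$. *)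

theory Defs
  imports "HOL-Algebra.Free_Abelian_Groups"
begin

section \<open>Group presentations\<close>

text \<open>The letter \<open>(x, True)\<close> stands for the generator \<open>x\<close>, and \<open>(x, False)\<close> for its inverse.\<close>

type_synonym 'a word = "('a \<times> bool) list"

inductive_set pres_cong :: "'a set \<Rightarrow> ('a word \<times> 'a word) set \<Rightarrow> ('a word \<times> 'a word) set"
  for X :: "'a set" and R :: "('a word \<times> 'a word) set"
  where
    refl: "w \<in> lists (X \<times> UNIV) \<Longrightarrow> (w, w) \<in> pres_cong X R"
  | sym: "(u, v) \<in> pres_cong X R \<Longrightarrow> (v, u) \<in> pres_cong X R"
  | trans: "(u, v) \<in> pres_cong X R \<Longrightarrow> (v, w) \<in> pres_cong X R \<Longrightarrow> (u, w) \<in> pres_cong X R"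
  | append: "(u, u') \<in> pres_cong X R \<Longrightarrow> (v, v') \<in> pres_cong X R \<Longrightarrow> (u @ v, u' @ v') \<in> pres_cong X R"
  | cancel: "x \<in> X \<Longrightarrow> ([(x, b), (x, \<not> b)], []) \<in> pres_cong X R"
  | rel: "(u, v) \<in> R \<Longrightarrow> u \<in> lists (X \<times> UNIV) \<Longrightarrow> v \<in> lists (X \<times> UNIV) \<Longrightarrow> (u, v) \<in> pres_cong X R"

definition presented_group :: "'a set \<Rightarrow> ('a word \<times> 'a word) set \<Rightarrow> 'a word set monoid"
  where "presented_group X R =
    \<lparr>carrier = lists (X \<times> UNIV) // pres_cong X R,
     monoid.mult = (\<lambda>A B. \<Union>u\<in>A. \<Union>v\<in>B. pres_cong X R `` {u @ v}),
     one = pres_cong X R `` {[]}\<rparr>"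

lemma pres_cong_subset:
  "(u, v) \<in> pres_cong X R \<Longrightarrow> u \<in> lists (X \<times> UNIV) \<and> v \<in> lists (X \<times> UNIV)"
  by (induction rule: pres_cong.induct) auto

lemma equiv_pres_cong: "equiv (lists (X \<times> UNIV)) (pres_cong X R)"
proof (intro equivI refl_onI symI transI)
  show "pres_cong X R \<subseteq> lists (X \<times> UNIV) \<times> lists (X \<times> UNIV)"
    using pres_cong_subset by fast
qed (fact pres_cong.refl pres_cong.sym pres_cong.trans)+

lemma carrier_presented_groupE:
  assumes "g \<in> carrier (presented_group X R)"
  obtains w where "w \<in> lists (X \<times> UNIV)" "g = pres_cong X R `` {w}"
  using assms by (auto simp: presented_group_def elim!: quotientE)

lemma presented_group_classI:
  "w \<in> lists (X \<times> UNIV) \<Longrightarrow> pres_cong X R `` {w} \<in> carrier (presented_group X R)"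
  by (simp add: presented_group_def quotientI)

lemma one_presented_group: "\<one>\<^bsub>presented_group X R\<^esub> = pres_cong X R `` {[]}"
  by (simp add: presented_group_def)

lemma mult_presented_group:
  assumes "u \<in> lists (X \<times> UNIV)" "v \<in> lists (X \<times> UNIV)"
  shows "pres_cong X R `` {u} \<otimes>\<^bsub>presented_group X R\<^esub> pres_cong X R `` {v} = pres_cong X R `` {u @ v}"
proof -
  have "congruent2 (pres_cong X R) (pres_cong X R) (\<lambda>u v. pres_cong X R `` {u @ v})"
    by (intro congruent2I' equiv_class_eq[OF equiv_pres_cong] pres_cong.append)
  from UN_equiv_class2[OF equiv_pres_cong equiv_pres_cong this assms]
  show ?thesis by (simp add: presented_group_def)
qed

lemma pres_cong_inverse:
  assumes "w \<in> lists (X \<times> UNIV)"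
  shows "(rev (map (\<lambda>(x, b). (x, \<not> b)) w) @ w, []) \<in> pres_cong X R"
  using assms
proof (induction w rule: list.induct)
  case Nil
  then show ?case by (simp add: pres_cong.refl)
next
  case (Cons a w)
  obtain x b where a: "a = (x, b)" by force
  let ?r = "rev (map (\<lambda>(x, b). (x, \<not> b)) w)"
  have x: "x \<in> X" and w: "w \<in> lists (X \<times> UNIV)" using Cons.prems a by auto
  have r: "?r \<in> lists (X \<times> UNIV)" using w by (auto simp: in_lists_conv_set)
  have "([(x, \<not> b), (x, b)] @ w, [] @ w) \<in> pres_cong X R"
    using pres_cong.append[OF pres_cong.cancel[OF x, of "\<not> b"] pres_cong.refl[OF w]] by simp
  then have "(?r @ [(x, \<not> b), (x, b)] @ w, ?r @ [] @ w) \<in> pres_cong X R"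
    by (rule pres_cong.append[OF pres_cong.refl[OF r]])
  then show ?case
    using pres_cong.trans Cons.IH[OF w] a by fastforce
qed

lemma group_presented_group: "group (presented_group X R)"
proof (rule groupI)
  let ?G = "presented_group X R"
  show "\<one>\<^bsub>?G\<^esub> \<in> carrier ?G"
    by (simp add: one_presented_group presented_group_classI)
  fix x assume "x \<in> carrier ?G"
  then obtain u where u: "u \<in> lists (X \<times> UNIV)" "x = pres_cong X R `` {u}"
    by (rule carrier_presented_groupE)
  show "\<one>\<^bsub>?G\<^esub> \<otimes>\<^bsub>?G\<^esub> x = x"
    using u by (simp add: one_presented_group mult_presented_group del: in_lists_conv_set)
  have r: "rev (map (\<lambda>(x, b). (x, \<not> b)) u) \<in> lists (X \<times> UNIV)"
    using u(1) by (auto simp: in_lists_conv_set)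
  show "\<exists>y\<in>carrier ?G. y \<otimes>\<^bsub>?G\<^esub> x = \<one>\<^bsub>?G\<^esub>"
    by (rule bexI[OF _ presented_group_classI[OF r]])
       (simp only: u(2) one_presented_group mult_presented_group[OF r u(1)]
          equiv_class_eq[OF equiv_pres_cong pres_cong_inverse[OF u(1)]])
  fix y assume "y \<in> carrier ?G"
  then obtain v where v: "v \<in> lists (X \<times> UNIV)" "y = pres_cong X R `` {v}"
    by (rule carrier_presented_groupE)
  have uv: "u @ v \<in> lists (X \<times> UNIV)" using u(1) v(1) by simp
  show "x \<otimes>\<^bsub>?G\<^esub> y \<in> carrier ?G"
    using presented_group_classI[OF uv] mult_presented_group[OF u(1) v(1)] u(2) v(2) by simp
  fix z assume "z \<in> carrier ?G"
  then obtain w where w: "w \<in> lists (X \<times> UNIV)" "z = pres_cong X R `` {w}"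
    by (rule carrier_presented_groupE)
  have vw: "v @ w \<in> lists (X \<times> UNIV)" using v(1) w(1) by simp
  show "x \<otimes>\<^bsub>?G\<^esub> y \<otimes>\<^bsub>?G\<^esub> z = x \<otimes>\<^bsub>?G\<^esub> (y \<otimes>\<^bsub>?G\<^esub> z)"
    by (simp only: u(2) v(2) w(2) mult_presented_group[OF u(1) v(1)] mult_presented_group[OF v(1) w(1)]
        mult_presented_group[OF uv w(1)] mult_presented_group[OF u(1) vw] append_assoc)
qed

lemma the_elem_pres_cong:
  assumes "w \<in> lists (X \<times> UNIV)" "\<And>v. (w, v) \<in> pres_cong X R \<Longrightarrow> f v = f w"
  shows "the_elem (f ` (pres_cong X R `` {w})) = f w"
  using assms pres_cong.refl[OF assms(1)]
  by (intro the_elem_image_unique) blast+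


section \<open>Quandles and their adjoint groups\<close>

record 'a quandle_struct = "'a partial_object" +
  qop :: "'a \<Rightarrow> 'a \<Rightarrow> 'a"  (infixl \<open>\<star>\<index>\<close> 70)

locale quandle =
  fixes Q :: "('a, 'b) quandle_struct_scheme" (structure)
  assumes qop_closed: "\<lbrakk>x \<in> carrier Q; y \<in> carrier Q\<rbrakk> \<Longrightarrow> x \<star> y \<in> carrier Q"
    and qop_idem: "x \<in> carrier Q \<Longrightarrow> x \<star> x = x"
    and qop_bij: "x \<in> carrier Q \<Longrightarrow> bij_betw (\<lambda>y. y \<star> x) (carrier Q) (carrier Q)"
    and qop_distrib: "\<lbrakk>x \<in> carrier Q; y \<in> carrier Q; z \<in> carrier Q\<rbrakk>
      \<Longrightarrow> (x \<star> y) \<star> z = (x \<star> z) \<star> (y \<star> z)"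

definition adj_rels :: "('a, 'b) quandle_struct_scheme \<Rightarrow> ('a word \<times> 'a word) set"
  where "adj_rels Q = {([(y \<star>\<^bsub>Q\<^esub> x, True)], [(x, False), (y, True), (x, True)]) | x y.
    x \<in> carrier Q \<and> y \<in> carrier Q}"

definition Adj :: "('a, 'b) quandle_struct_scheme \<Rightarrow> 'a word set monoid"
  where "Adj Q = presented_group (carrier Q) (adj_rels Q)"

definition adj_gen :: "('a, 'b) quandle_struct_scheme \<Rightarrow> 'a \<Rightarrow> 'a word set"
  where "adj_gen Q x = pres_cong (carrier Q) (adj_rels Q) `` {[(x, True)]}"

text \<open>In \<open>adj_eps\<close> and \<open>adj_act\<close> below, the function under the image is constant on each
  element of \<open>Adj Q\<close>, which is a congruence class of words.\<close>

definition word_eps :: "'a word \<Rightarrow> int"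
  where "word_eps w = (\<Sum>(x, b)\<leftarrow>w. if b then 1 else - 1)"

definition adj_eps :: "'a word set \<Rightarrow> int"
  where "adj_eps g = the_elem (word_eps ` g)"

definition letter_act :: "('a, 'b) quandle_struct_scheme \<Rightarrow> 'a \<Rightarrow> 'a \<times> bool \<Rightarrow> 'a"
  where "letter_act Q p = (\<lambda>(x, b). if b then p \<star>\<^bsub>Q\<^esub> x else inv_into (carrier Q) (\<lambda>y. y \<star>\<^bsub>Q\<^esub> x) p)"

definition adj_act :: "('a, 'b) quandle_struct_scheme \<Rightarrow> 'a \<Rightarrow> 'a word set \<Rightarrow> 'a"
  where "adj_act Q p g = the_elem (foldl (letter_act Q) p ` g)"

definition fundamental_group :: "('a, 'b) quandle_struct_scheme \<Rightarrow> 'a \<Rightarrow> 'a word set monoid"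
  where "fundamental_group Q q =
    (Adj Q)\<lparr>carrier := {g \<in> kernel (Adj Q) integer_group adj_eps. adj_act Q q g = q}\<rparr>"

lemma group_Adj: "group (Adj Q)"
  by (simp add: Adj_def group_presented_group)

lemma word_eps_cong: "(u, v) \<in> pres_cong (carrier Q) (adj_rels Q) \<Longrightarrow> word_eps u = word_eps v"
  by (induction rule: pres_cong.induct) (auto simp: word_eps_def adj_rels_def)

lemma adj_eps_class:
  "w \<in> lists (carrier Q \<times> UNIV) \<Longrightarrow> adj_eps (pres_cong (carrier Q) (adj_rels Q) `` {w}) = word_eps w"
  unfolding adj_eps_def by (rule the_elem_pres_cong) (auto dest: word_eps_cong)

lemma adj_eps_hom: "adj_eps \<in> hom (Adj Q) integer_group"
proof (rule homI)
  fix g h assume "g \<in> carrier (Adj Q)" "h \<in> carrier (Adj Q)"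
  then obtain u v where u: "u \<in> lists (carrier Q \<times> UNIV)" "g = pres_cong (carrier Q) (adj_rels Q) `` {u}"
    and v: "v \<in> lists (carrier Q \<times> UNIV)" "h = pres_cong (carrier Q) (adj_rels Q) `` {v}"
    unfolding Adj_def by (elim carrier_presented_groupE)
  have uv: "u @ v \<in> lists (carrier Q \<times> UNIV)" using u(1) v(1) by simp
  show "adj_eps (g \<otimes>\<^bsub>Adj Q\<^esub> h) = adj_eps g \<otimes>\<^bsub>integer_group\<^esub> adj_eps h"
    by (simp only: u(2) v(2) Adj_def mult_presented_group[OF u(1) v(1)]
        adj_eps_class[OF u(1)] adj_eps_class[OF v(1)] adj_eps_class[OF uv])
       (simp add: word_eps_def)
qed simp

lemma adj_eps_gen: "x \<in> carrier Q \<Longrightarrow> adj_eps (adj_gen Q x) = 1"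
  unfolding adj_gen_def by (subst adj_eps_class) (auto simp: word_eps_def)

context quandle
begin

lemma letter_act_closed: "p \<in> carrier Q \<Longrightarrow> a \<in> carrier Q \<times> UNIV \<Longrightarrow> letter_act Q p a \<in> carrier Q"
  using qop_bij[of "fst a"] qop_closed
  by (auto simp: letter_act_def bij_betw_def intro!: inv_into_into)

lemma foldl_letter_act_closed:
  "w \<in> lists (carrier Q \<times> UNIV) \<Longrightarrow> p \<in> carrier Q \<Longrightarrow> foldl (letter_act Q) p w \<in> carrier Q"
proof (induction w arbitrary: p)
  case (Cons a w)
  then have "letter_act Q p a \<in> carrier Q" using letter_act_closed[of p a] by auto
  with Cons show ?case by simp
qed simp

lemma foldl_letter_act_cong:
  "(u, v) \<in> pres_cong (carrier Q) (adj_rels Q) \<Longrightarrow> p \<in> carrier Q \<Longrightarrow>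
    foldl (letter_act Q) p u = foldl (letter_act Q) p v"
proof (induction arbitrary: p rule: pres_cong.induct)
  case (append u u' v v')
  then show ?case
    using foldl_letter_act_closed pres_cong_subset by (metis foldl_append)
next
  case (cancel x b)
  then show ?case
    using bij_betw_inv_into_left[OF qop_bij[of x]] bij_betw_inv_into_right[OF qop_bij[of x]]
    by (cases b) (auto simp: letter_act_def)
next
  case (rel u v)
  then obtain x y where x: "x \<in> carrier Q" and y: "y \<in> carrier Q"
    and u: "u = [(y \<star> x, True)]" and v: "v = [(x, False), (y, True), (x, True)]"
    by (auto simp: adj_rels_def)
  obtain r where r: "r \<in> carrier Q" "p = r \<star> x"
    using qop_bij[OF x] \<open>p \<in> carrier Q\<close> by (auto simp: bij_betw_def)
  have "inv_into (carrier Q) (\<lambda>y. y \<star> x) p = r"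
    using bij_betw_inv_into_left[OF qop_bij[OF x]] r by simp
  then show ?case
    using qop_distrib[OF r(1) y x] r(2) by (simp add: u v letter_act_def)
qed auto

lemma adj_act_class:
  "w \<in> lists (carrier Q \<times> UNIV) \<Longrightarrow> p \<in> carrier Q \<Longrightarrow>
    adj_act Q p (pres_cong (carrier Q) (adj_rels Q) `` {w}) = foldl (letter_act Q) p w"
  unfolding adj_act_def by (rule the_elem_pres_cong) (auto dest: foldl_letter_act_cong)

lemma adj_act_closed:
  "g \<in> carrier (Adj Q) \<Longrightarrow> p \<in> carrier Q \<Longrightarrow> adj_act Q p g \<in> carrier Q"
  unfolding Adj_def
  by (elim carrier_presented_groupE) (metis adj_act_class foldl_letter_act_closed)

lemma adj_act_gen: "x \<in> carrier Q \<Longrightarrow> p \<in> carrier Q \<Longrightarrow> adj_act Q p (adj_gen Q x) = p \<star> x"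
  unfolding adj_gen_def by (subst adj_act_class) (auto simp: letter_act_def)

lemma adj_act_one: "p \<in> carrier Q \<Longrightarrow> adj_act Q p \<one>\<^bsub>Adj Q\<^esub> = p"
  by (simp add: Adj_def one_presented_group adj_act_class)

lemma adj_act_mult:
  assumes "g \<in> carrier (Adj Q)" "h \<in> carrier (Adj Q)" "p \<in> carrier Q"
  shows "adj_act Q p (g \<otimes>\<^bsub>Adj Q\<^esub> h) = adj_act Q (adj_act Q p g) h"
proof -
  obtain u v where u: "u \<in> lists (carrier Q \<times> UNIV)" "g = pres_cong (carrier Q) (adj_rels Q) `` {u}"
    and v: "v \<in> lists (carrier Q \<times> UNIV)" "h = pres_cong (carrier Q) (adj_rels Q) `` {v}"
    using assms unfolding Adj_def by (elim carrier_presented_groupE)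
  have uv: "u @ v \<in> lists (carrier Q \<times> UNIV)" using u(1) v(1) by simp
  show ?thesis
    by (simp only: u(2) v(2) Adj_def mult_presented_group[OF u(1) v(1)]
        adj_act_class[OF u(1) assms(3)] adj_act_class[OF uv assms(3)]
        adj_act_class[OF v(1) foldl_letter_act_closed[OF u(1) assms(3)]] foldl_append)
qed

lemma group_fundamental_group:
  assumes "q \<in> carrier Q"
  shows "group (fundamental_group Q q)"
proof -
  interpret A: group "Adj Q" by (rule group_Adj)
  interpret E: group_hom "Adj Q" integer_group adj_eps
    by (intro group_hom.intro group_hom_axioms.intro adj_eps_hom A.is_group group_integer_group)
  have "subgroup {g \<in> kernel (Adj Q) integer_group adj_eps. adj_act Q q g = q} (Adj Q)"
  proof (rule A.subgroupI)
    show "{g \<in> kernel (Adj Q) integer_group adj_eps. adj_act Q q g = q} \<noteq> {}"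
      using adj_act_one[OF assms] subgroup.one_closed[OF E.subgroup_kernel] by blast
    fix g assume g: "g \<in> {g \<in> kernel (Adj Q) integer_group adj_eps. adj_act Q q g = q}"
    then have gc: "g \<in> carrier (Adj Q)" by (simp add: kernel_def)
    have "adj_act Q q (inv\<^bsub>Adj Q\<^esub> g) = adj_act Q (adj_act Q q g) (inv\<^bsub>Adj Q\<^esub> g)"
      using g by simp
    also have "\<dots> = q"
      using adj_act_mult[OF gc A.inv_closed[OF gc] assms] adj_act_one[OF assms] gc by simp
    finally show "inv\<^bsub>Adj Q\<^esub> g \<in> {g \<in> kernel (Adj Q) integer_group adj_eps. adj_act Q q g = q}"
      using g subgroup.m_inv_closed[OF E.subgroup_kernel] by simp
    fix h assume h: "h \<in> {g \<in> kernel (Adj Q) integer_group adj_eps. adj_act Q q g = q}"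
    then have hc: "h \<in> carrier (Adj Q)" by (simp add: kernel_def)
    show "g \<otimes>\<^bsub>Adj Q\<^esub> h \<in> {g \<in> kernel (Adj Q) integer_group adj_eps. adj_act Q q g = q}"
      using g h adj_act_mult[OF gc hc assms] subgroup.m_closed[OF E.subgroup_kernel] by simp
  qed (auto simp: kernel_def)
  then show ?thesis
    unfolding fundamental_group_def by (rule A.subgroup_imp_group)
qed

end


section \<open>Alexander quandles\<close>

text \<open>Abelian groups are written multiplicatively, as is usual for \<^locale>\<open>comm_group\<close>.\<close>

definition alexander_quandle :: "('a, 'b) monoid_scheme \<Rightarrow> ('a \<Rightarrow> 'a) \<Rightarrow> 'a quandle_struct"
  where "alexander_quandle M T =
    \<lparr>carrier = carrier M, qop = (\<lambda>y x. T y \<otimes>\<^bsub>M\<^esub> x \<otimes>\<^bsub>M\<^esub> inv\<^bsub>M\<^esub> (T x))\<rparr>"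

lemma quandle_alexander_quandle:
  assumes "comm_group M" "T \<in> iso M M"
  shows "quandle (alexander_quandle M T)"
proof -
  interpret comm_group M by fact
  have hom: "T \<in> hom M M" and bij: "bij_betw T (carrier M) (carrier M)"
    using assms(2) by (auto simp: iso_def)
  have [simp]: "T x \<in> carrier M" if "x \<in> carrier M" for x
    using hom that by (auto simp: hom_def)
  have [simp]: "T (x \<otimes>\<^bsub>M\<^esub> y) = T x \<otimes>\<^bsub>M\<^esub> T y" if "x \<in> carrier M" "y \<in> carrier M" for x y
    using hom that by (auto simp: hom_def)
  have [simp]: "T (inv\<^bsub>M\<^esub> x) = inv\<^bsub>M\<^esub> (T x)" if "x \<in> carrier M" for x
    using group_hom.hom_inv[of M M T x] hom that is_group
    by (simp add: group_hom_def group_hom_axioms_def)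
  show ?thesis
  proof
    fix x assume "x \<in> carrier (alexander_quandle M T)"
    then have x: "x \<in> carrier M" by (simp add: alexander_quandle_def)
    show "x \<star>\<^bsub>alexander_quandle M T\<^esub> x = x"
      using x by (simp add: alexander_quandle_def m_ac)
    have "bij_betw (\<lambda>z. z \<otimes>\<^bsub>M\<^esub> (x \<otimes>\<^bsub>M\<^esub> inv\<^bsub>M\<^esub> (T x))) (carrier M) (carrier M)"
      by (rule bij_betw_byWitness[where f' = "\<lambda>z. z \<otimes>\<^bsub>M\<^esub> inv\<^bsub>M\<^esub> (x \<otimes>\<^bsub>M\<^esub> inv\<^bsub>M\<^esub> (T x))"])
         (use x in \<open>auto simp: m_assoc\<close>)
    from bij_betw_trans[OF bij this]
    have "bij_betw (\<lambda>y. T y \<otimes>\<^bsub>M\<^esub> (x \<otimes>\<^bsub>M\<^esub> inv\<^bsub>M\<^esub> (T x))) (carrier M) (carrier M)"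
      by (simp add: comp_def)
    then have "bij_betw (\<lambda>y. T y \<otimes>\<^bsub>M\<^esub> x \<otimes>\<^bsub>M\<^esub> inv\<^bsub>M\<^esub> (T x)) (carrier M) (carrier M)"
      using x by (simp add: m_assoc cong: bij_betw_cong)
    then show "bij_betw (\<lambda>y. y \<star>\<^bsub>alexander_quandle M T\<^esub> x)
        (carrier (alexander_quandle M T)) (carrier (alexander_quandle M T))"
      by (simp add: alexander_quandle_def)
  next
    have cancel: "P \<otimes>\<^bsub>M\<^esub> (inv\<^bsub>M\<^esub> c \<otimes>\<^bsub>M\<^esub> inv\<^bsub>M\<^esub> R) = c \<otimes>\<^bsub>M\<^esub> (P \<otimes>\<^bsub>M\<^esub> (d \<otimes>\<^bsub>M\<^esub>
        (inv\<^bsub>M\<^esub> c \<otimes>\<^bsub>M\<^esub> (inv\<^bsub>M\<^esub> c \<otimes>\<^bsub>M\<^esub> (inv\<^bsub>M\<^esub> R \<otimes>\<^bsub>M\<^esub> inv\<^bsub>M\<^esub> d)))))"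
      if "P \<in> carrier M" "R \<in> carrier M" "c \<in> carrier M" "d \<in> carrier M" for P R c d
    proof -
      have "P \<otimes>\<^bsub>M\<^esub> (inv\<^bsub>M\<^esub> c \<otimes>\<^bsub>M\<^esub> inv\<^bsub>M\<^esub> R) =
          (P \<otimes>\<^bsub>M\<^esub> (inv\<^bsub>M\<^esub> c \<otimes>\<^bsub>M\<^esub> inv\<^bsub>M\<^esub> R)) \<otimes>\<^bsub>M\<^esub> ((c \<otimes>\<^bsub>M\<^esub> inv\<^bsub>M\<^esub> c) \<otimes>\<^bsub>M\<^esub> (d \<otimes>\<^bsub>M\<^esub> inv\<^bsub>M\<^esub> d))"
        using that by (simp only: r_inv r_one l_one m_closed inv_closed one_closed)
      also have "\<dots> = c \<otimes>\<^bsub>M\<^esub> (P \<otimes>\<^bsub>M\<^esub> (d \<otimes>\<^bsub>M\<^esub>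
          (inv\<^bsub>M\<^esub> c \<otimes>\<^bsub>M\<^esub> (inv\<^bsub>M\<^esub> c \<otimes>\<^bsub>M\<^esub> (inv\<^bsub>M\<^esub> R \<otimes>\<^bsub>M\<^esub> inv\<^bsub>M\<^esub> d)))))"
        using that by (simp only: m_ac m_closed inv_closed)
      finally show ?thesis .
    qed
    fix x y z
    assume "x \<in> carrier (alexander_quandle M T)" "y \<in> carrier (alexander_quandle M T)"
      "z \<in> carrier (alexander_quandle M T)"
    then show "x \<star>\<^bsub>alexander_quandle M T\<^esub> y \<star>\<^bsub>alexander_quandle M T\<^esub> z =
        x \<star>\<^bsub>alexander_quandle M T\<^esub> z \<star>\<^bsub>alexander_quandle M T\<^esub> (y \<star>\<^bsub>alexander_quandle M T\<^esub> z)"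
      by (auto simp: alexander_quandle_def m_ac inv_mult intro!: cancel)
  qed (auto simp: alexander_quandle_def)
qed


section \<open>Tensor products over the integers\<close>

definition bilinear_rels ::
    "('a, 'c) monoid_scheme \<Rightarrow> ('b, 'd) monoid_scheme \<Rightarrow> (('a \<times> 'b) \<Rightarrow>\<^sub>0 int) set"
  where "bilinear_rels M N =
    {frag_of (x \<otimes>\<^bsub>M\<^esub> x', y) - frag_of (x, y) - frag_of (x', y) | x x' y.
       x \<in> carrier M \<and> x' \<in> carrier M \<and> y \<in> carrier N} \<union>
    {frag_of (x, y \<otimes>\<^bsub>N\<^esub> y') - frag_of (x, y) - frag_of (x, y') | x y y'.
       x \<in> carrier M \<and> y \<in> carrier N \<and> y' \<in> carrier N}"

definition bilinear_subgroup ::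
    "('a, 'c) monoid_scheme \<Rightarrow> ('b, 'd) monoid_scheme \<Rightarrow> (('a \<times> 'b) \<Rightarrow>\<^sub>0 int) set"
  where "bilinear_subgroup M N =
    generate (free_Abelian_group (carrier M \<times> carrier N)) (bilinear_rels M N)"

definition tensor_product ::
    "('a, 'c) monoid_scheme \<Rightarrow> ('b, 'd) monoid_scheme \<Rightarrow> (('a \<times> 'b) \<Rightarrow>\<^sub>0 int) set monoid"
  where "tensor_product M N =
    free_Abelian_group (carrier M \<times> carrier N) Mod bilinear_subgroup M N"

definition tensor_coset ::
    "('a, 'c) monoid_scheme \<Rightarrow> ('b, 'd) monoid_scheme \<Rightarrow> (('a \<times> 'b) \<Rightarrow>\<^sub>0 int) \<Rightarrow> (('a \<times> 'b) \<Rightarrow>\<^sub>0 int) set"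
  where "tensor_coset M N f =
    bilinear_subgroup M N #>\<^bsub>free_Abelian_group (carrier M \<times> carrier N)\<^esub> f"

definition pure_tensor ::
    "('a, 'c) monoid_scheme \<Rightarrow> ('b, 'd) monoid_scheme \<Rightarrow> 'a \<Rightarrow> 'b \<Rightarrow> (('a \<times> 'b) \<Rightarrow>\<^sub>0 int) set"
  where "pure_tensor M N x y = tensor_coset M N (frag_of (x, y))"

text \<open>The union in \<open>tau\<close> ranges over the representatives of a coset, all of which contribute the
  same coset. Lemmas \<open>tau_hom\<close>, \<open>tau_pure_tensor\<close> and \<open>tau_unique\<close> below show that \<open>tau M T\<close> is the
  additive map determined by its values on pure tensors.\<close>

definition tau_lift :: "('a \<Rightarrow> 'a) \<Rightarrow> (('a \<times> 'a) \<Rightarrow>\<^sub>0 int) \<Rightarrow> (('a \<times> 'a) \<Rightarrow>\<^sub>0 int)"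
  where "tau_lift T = frag_extend (\<lambda>(x, y). frag_of (T y, x))"

definition tau :: "('a, 'b) monoid_scheme \<Rightarrow> ('a \<Rightarrow> 'a) \<Rightarrow>
    (('a \<times> 'a) \<Rightarrow>\<^sub>0 int) set \<Rightarrow> (('a \<times> 'a) \<Rightarrow>\<^sub>0 int) set"
  where "tau M T t = (\<Union>f\<in>t. tensor_coset M M (tau_lift T f))"

definition S_group :: "('a, 'b) monoid_scheme \<Rightarrow> ('a \<Rightarrow> 'a) \<Rightarrow> (('a \<times> 'a) \<Rightarrow>\<^sub>0 int) set set monoid"
  where "S_group M T = tensor_product M M Mod
    ((\<lambda>t. t \<otimes>\<^bsub>tensor_product M M\<^esub> inv\<^bsub>tensor_product M M\<^esub> (tau M T t)) ` carrier (tensor_product M M))"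

lemma bilinear_rels_subset:
  assumes "comm_group M" "comm_group N"
  shows "bilinear_rels M N \<subseteq> carrier (free_Abelian_group (carrier M \<times> carrier N))"
proof -
  interpret M: comm_group M by fact
  interpret N: comm_group N by fact
  have "Poly_Mapping.keys (frag_of a - frag_of b - frag_of c) \<subseteq> {a, b, c}" for a b c :: "'a \<times> 'c"
    using keys_diff[of "frag_of a - frag_of b" "frag_of c"] keys_diff[of "frag_of a" "frag_of b"]
    by auto
  then show ?thesis
    unfolding bilinear_rels_def by (fastforce simp: carrier_free_Abelian_group_iff)
qed

lemma normal_bilinear_subgroup:
  assumes "comm_group M" "comm_group N"
  shows "bilinear_subgroup M N \<lhd> free_Abelian_group (carrier M \<times> carrier N)"
  using group.generate_is_subgroup[OF group_free_Abelian_group bilinear_rels_subset[OF assms]]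
  by (simp add: bilinear_subgroup_def comm_group.normal_iff_subgroup abelian_free_Abelian_group)

lemma comm_group_tensor_product:
  assumes "comm_group M" "comm_group N"
  shows "comm_group (tensor_product M N)"
  unfolding tensor_product_def
  by (intro comm_group.abelian_FactGroup abelian_free_Abelian_group normal_imp_subgroup
      normal_bilinear_subgroup assms)

lemma group_hom_tensor_coset:
  assumes "comm_group M" "comm_group N"
  shows "group_hom (free_Abelian_group (carrier M \<times> carrier N)) (tensor_product M N) (tensor_coset M N)"
proof -
  have "tensor_coset M N \<in> hom (free_Abelian_group (carrier M \<times> carrier N)) (tensor_product M N)"
    using normal.r_coset_hom_Mod[OF normal_bilinear_subgroup[OF assms]]
    by (simp add: tensor_coset_def[abs_def] tensor_product_def)
  then show ?thesis
    using comm_group_tensor_product[OF assms]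
    by (simp add: group_hom_def group_hom_axioms_def comm_group_def)
qed

lemma tensor_product_carrierE:
  assumes "t \<in> carrier (tensor_product M N)"
  obtains f where "f \<in> carrier (free_Abelian_group (carrier M \<times> carrier N))" "t = tensor_coset M N f"
  using assms by (auto simp: tensor_product_def carrier_FactGroup tensor_coset_def)

lemma tau_lift_closed:
  assumes "T \<in> carrier M \<rightarrow> carrier M" "f \<in> carrier (free_Abelian_group (carrier M \<times> carrier M))"
  shows "tau_lift T f \<in> carrier (free_Abelian_group (carrier M \<times> carrier M))"
proof -
  have f: "Poly_Mapping.keys f \<subseteq> carrier M \<times> carrier M"
    using assms(2) by simp
  have "Poly_Mapping.keys (tau_lift T f) \<subseteq>
      (\<Union>z\<in>Poly_Mapping.keys f. Poly_Mapping.keys (case z of (x, y) \<Rightarrow> frag_of (T y, x)))"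
    unfolding tau_lift_def by (rule keys_frag_extend)
  also have "\<dots> \<subseteq> carrier M \<times> carrier M"
    using f assms(1) by fastforce
  finally show ?thesis by simp
qed

lemma tau_lift_bilinear_subgroup:
  assumes "comm_group M" "T \<in> hom M M" "f \<in> bilinear_subgroup M M"
  shows "tau_lift T f \<in> bilinear_subgroup M M"
proof -
  let ?F = "free_Abelian_group (carrier M \<times> carrier M)"
  interpret M: comm_group M by fact
  have T: "T x \<in> carrier M" if "x \<in> carrier M" for x
    using assms(2) that by (auto simp: hom_def)
  have Tm: "T (x \<otimes>\<^bsub>M\<^esub> y) = T x \<otimes>\<^bsub>M\<^esub> T y" if "x \<in> carrier M" "y \<in> carrier M" for x y
    using assms(2) that by (auto simp: hom_def)
  have rels: "tau_lift T r \<in> bilinear_rels M M" if "r \<in> bilinear_rels M M" for r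
    using that unfolding bilinear_rels_def
  proof (elim UnE CollectE exE conjE, goal_cases)
    case (1 x x' y)
    have "tau_lift T r = frag_of (T y, x \<otimes>\<^bsub>M\<^esub> x') - frag_of (T y, x) - frag_of (T y, x')"
      by (simp add: 1 tau_lift_def frag_extend_diff)
    with 1 T show ?case by blast
  next
    case (2 x y y')
    have "tau_lift T r = frag_of (T y \<otimes>\<^bsub>M\<^esub> T y', x) - frag_of (T y, x) - frag_of (T y', x)"
      by (simp add: 2 Tm tau_lift_def frag_extend_diff)
    with 2 T show ?case by blast
  qed
  from assms(3) show ?thesis
    unfolding bilinear_subgroup_def
  proof (induction rule: generate.induct)
    case one
    then show ?case using generate.one[of ?F] by (simp add: tau_lift_def)
  next
    case (incl h)
    then show ?case by (intro generate.incl rels)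
  next
    case (inv h)
    then have "h \<in> carrier ?F" "tau_lift T h \<in> carrier ?F"
      using bilinear_rels_subset[OF assms(1) assms(1)] rels by blast+
    then have "tau_lift T (inv\<^bsub>?F\<^esub> h) = inv\<^bsub>?F\<^esub> (tau_lift T h)"
      by (simp add: tau_lift_def frag_extend_minus)
    then show ?case using generate.inv[OF rels[OF inv]] by simp
  next
    case (eng h1 h2)
    then show ?case
      using generate.eng[OF eng.IH] by (simp add: tau_lift_def frag_extend_add)
  qed
qed

lemma tau_tensor_coset:
  assumes "comm_group M" "T \<in> hom M M" "f \<in> carrier (free_Abelian_group (carrier M \<times> carrier M))"
  shows "tau M T (tensor_coset M M f) = tensor_coset M M (tau_lift T f)"
proof -
  let ?F = "free_Abelian_group (carrier M \<times> carrier M)" and ?N = "bilinear_subgroup M M"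
  have T: "T \<in> carrier M \<rightarrow> carrier M" using assms(2) by (auto simp: hom_def)
  have N: "subgroup ?N ?F"
    using normal_bilinear_subgroup[OF assms(1) assms(1)] by (rule normal_imp_subgroup)
  have "tensor_coset M M (tau_lift T g) = tensor_coset M M (tau_lift T f)"
    if g: "g \<in> tensor_coset M M f" for g
  proof -
    obtain n where n: "n \<in> ?N" "g = n + f"
      using g by (auto simp: tensor_coset_def r_coset_def)
    have "tau_lift T g \<in> ?N #>\<^bsub>?F\<^esub> tau_lift T f"
      using tau_lift_bilinear_subgroup[OF assms(1,2) n(1)]
      by (auto simp: n(2) tau_lift_def frag_extend_add r_coset_def)
    then show ?thesis
      unfolding tensor_coset_def
      using group.repr_independence[OF group_free_Abelian_group _ tau_lift_closed[OF T assms(3)] N]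
      by metis
  qed
  moreover have "f \<in> tensor_coset M M f"
    unfolding tensor_coset_def
    using assms(3) N group.rcos_self[OF group_free_Abelian_group] by blast
  ultimately show ?thesis
    unfolding tau_def by blast
qed

lemma tau_hom:
  assumes "comm_group M" "T \<in> hom M M"
  shows "tau M T \<in> hom (tensor_product M M) (tensor_product M M)"
proof (rule homI)
  let ?F = "free_Abelian_group (carrier M \<times> carrier M)"
  interpret q: group_hom ?F "tensor_product M M" "tensor_coset M M"
    by (rule group_hom_tensor_coset[OF assms(1) assms(1)])
  have T: "T \<in> carrier M \<rightarrow> carrier M" using assms(2) by (auto simp: hom_def)
  fix s assume "s \<in> carrier (tensor_product M M)"
  then obtain f where f: "f \<in> carrier ?F" "s = tensor_coset M M f"
    by (rule tensor_product_carrierE)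
  show "tau M T s \<in> carrier (tensor_product M M)"
    using q.hom_closed[OF tau_lift_closed[OF T f(1)]] tau_tensor_coset[OF assms f(1)] f(2) by simp
  fix t assume "t \<in> carrier (tensor_product M M)"
  then obtain g where g: "g \<in> carrier ?F" "t = tensor_coset M M g"
    by (rule tensor_product_carrierE)
  have "tau_lift T (f \<otimes>\<^bsub>?F\<^esub> g) = tau_lift T f \<otimes>\<^bsub>?F\<^esub> tau_lift T g"
    by (simp add: tau_lift_def frag_extend_add)
  then show "tau M T (s \<otimes>\<^bsub>tensor_product M M\<^esub> t) = tau M T s \<otimes>\<^bsub>tensor_product M M\<^esub> tau M T t"
    by (simp only: f(2) g(2) q.hom_mult[OF f(1) g(1), symmetric] tau_tensor_coset[OF assms f(1)]
        tau_tensor_coset[OF assms g(1)] tau_tensor_coset[OF assms q.G.m_closed[OF f(1) g(1)]]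
        q.hom_mult[OF tau_lift_closed[OF T f(1)] tau_lift_closed[OF T g(1)]])
qed

lemma tau_pure_tensor:
  assumes "comm_group M" "T \<in> hom M M" "x \<in> carrier M" "y \<in> carrier M"
  shows "tau M T (pure_tensor M M x y) = pure_tensor M M (T y) x"
proof -
  have "frag_of (x, y) \<in> carrier (free_Abelian_group (carrier M \<times> carrier M))"
    using assms(3,4) by simp
  from tau_tensor_coset[OF assms(1,2) this] show ?thesis
    by (simp add: pure_tensor_def tau_lift_def)
qed

lemma tau_unique:
  assumes "comm_group M" "T \<in> hom M M"
    and h: "h \<in> hom (tensor_product M M) (tensor_product M M)"
    and ht: "\<And>x y. x \<in> carrier M \<Longrightarrow> y \<in> carrier M \<Longrightarrow> h (pure_tensor M M x y) = pure_tensor M M (T y) x"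
    and "t \<in> carrier (tensor_product M M)"
  shows "h t = tau M T t"
proof -
  let ?F = "free_Abelian_group (carrier M \<times> carrier M)" and ?P = "tensor_product M M"
  interpret q: group_hom ?F ?P "tensor_coset M M"
    by (rule group_hom_tensor_coset[OF assms(1) assms(1)])
  interpret h: group_hom ?P ?P h
    by (intro group_hom.intro group_hom_axioms.intro h q.H.is_group)
  interpret u: group_hom ?P ?P "tau M T"
    by (intro group_hom.intro group_hom_axioms.intro tau_hom assms(1,2) q.H.is_group)
  obtain f where f: "Poly_Mapping.keys f \<subseteq> carrier M \<times> carrier M" "t = tensor_coset M M f"
    using assms(5) by (auto elim!: tensor_product_carrierE)
  have "Poly_Mapping.keys f \<subseteq> carrier M \<times> carrier M \<and>
      h (tensor_coset M M f) = tau M T (tensor_coset M M f)"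
    using f(1)
  proof (induction f rule: frag_induction)
    case zero
    have "tensor_coset M M 0 = \<one>\<^bsub>?P\<^esub>" using q.hom_one by simp
    then show ?case by (metis empty_subsetI h.hom_one keys_zero u.hom_one)
  next
    case (one z)
    then show ?case
      using ht tau_pure_tensor[OF assms(1,2)] by (cases z) (auto simp: pure_tensor_def)
  next
    case (diff a b)
    then have a: "a \<in> carrier ?F" and b: "b \<in> carrier ?F" by auto
    have "a - b = a \<otimes>\<^bsub>?F\<^esub> inv\<^bsub>?F\<^esub> b" using b by simp
    then have "tensor_coset M M (a - b) = tensor_coset M M a \<otimes>\<^bsub>?P\<^esub> inv\<^bsub>?P\<^esub> (tensor_coset M M b)"
      using a b by (metis q.G.inv_closed q.hom_inv q.hom_mult)
    moreover have "Poly_Mapping.keys (a - b) \<subseteq> carrier M \<times> carrier M"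
      using diff keys_diff[of a b] by blast
    ultimately show ?case
      using diff q.hom_closed[OF a] q.hom_closed[OF b] by simp
  qed
  then show ?thesis using f(2) by simp
qed

end

theory Submission
  imports Defs
begin

text \<open>Write \<open>M\<close> additively and put \<open>D = 1 - T\<close>. Elements of \<open>Adj Q\<close> act on \<open>Q\<close> by affine maps whose linear
  part is a power of \<open>T\<close>, so \<open>\<pi>\<^sub>1\<close> acts trivially and is central. The elements \<open>a x = e\<^sub>0\<inverse> e\<^sub>x\<close> lift the
  translations, and \<open>c x y = (a (x + y))\<inverse> (a x) (a y)\<close> is a cocycle with values in \<open>\<pi>\<^sub>1\<close>. The relation
  \<open>e\<^sub>y g = g e\<^bsub>y\<cdot>g\<^esub>\<close> for \<open>g = a x\<close> identifies \<open>c (D x) y\<close> with the commutator of \<open>a x\<close> and \<open>a y\<close>. Commutators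
  are biadditive and \<open>D\<close> is onto, so \<open>c\<close> is biadditive; expanding the commutator as
  \<open>c x y - c y x\<close> gives \<open>c (T x) y = c y x\<close>. Hence \<open>c\<close> induces a map from the cokernel of \<open>1 - \<tau>\<close>
  to \<open>\<pi>\<^sub>1\<close>. Its inverse comes from the action of \<open>Adj Q\<close> on \<open>M \<times> S\<close> in which \<open>e\<^sub>x\<close> sends \<open>(u, \<alpha>)\<close> to
  \<open>(T u + x, \<alpha> + [T u \<otimes> x])\<close>.\<close>

section \<open>The universal property of the cokernel\<close>

lemma group_homI:
  "\<lbrakk>group G; group H; h \<in> hom G H\<rbrakk> \<Longrightarrow> group_hom G H h"
  by (simp add: group_hom_def group_hom_axioms_def)

text \<open>Two representatives of one coset differ by an element of \<open>N\<close>, which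
  \<open>h\<close> kills. Serves twice below: for the passage to the tensor product and for the
  passage to the cokernel.\<close>

lemma FactGroup_factor_through:
  assumes "N \<lhd> G" "group H" "h \<in> hom G H" "\<And>n. n \<in> N \<Longrightarrow> h n = \<one>\<^bsub>H\<^esub>"
  obtains g where "g \<in> hom (G Mod N) H" "\<And>x. x \<in> carrier G \<Longrightarrow> g (N #>\<^bsub>G\<^esub> x) = h x"
proof -
  interpret N: normal N G by fact
  interpret h: group_hom G H h
    by (intro group_homI assms N.is_group)
  have "h x = h y" if "x \<in> carrier G" "y \<in> carrier G" "N #>\<^bsub>G\<^esub> x = N #>\<^bsub>G\<^esub> y" for x y
  proof -
    have "x \<in> N #>\<^bsub>G\<^esub> y"
      using N.rcos_self[OF that(1) N.subgroup_axioms] that(3) by simp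
    then obtain n where n: "n \<in> N" "x = n \<otimes>\<^bsub>G\<^esub> y"
      by (auto simp: r_coset_def)
    then show ?thesis
      using assms(4) that N.mem_carrier by simp
  qed
  from FactGroup_universal[OF assms(3,1) this] that show thesis by blast
qed

definition one_minus_tau_image where
  "one_minus_tau_image M T =
    (\<lambda>t. t \<otimes>\<^bsub>tensor_product M M\<^esub> inv\<^bsub>tensor_product M M\<^esub> (tau M T t)) ` carrier (tensor_product M M)"

definition S_class where
  "S_class M T x y = one_minus_tau_image M T #>\<^bsub>tensor_product M M\<^esub> pure_tensor M M x y"

lemma S_group_eq: "S_group M T = tensor_product M M Mod one_minus_tau_image M T"
  by (simp add: S_group_def one_minus_tau_image_def)

lemma one_minus_tau_hom:
  assumes "comm_group M" "T \<in> hom M M"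
  shows "(\<lambda>t. t \<otimes>\<^bsub>tensor_product M M\<^esub> inv\<^bsub>tensor_product M M\<^esub> (tau M T t))
    \<in> hom (tensor_product M M) (tensor_product M M)"
proof -
  interpret P: comm_group "tensor_product M M"
    by (rule comm_group_tensor_product[OF assms(1) assms(1)])
  interpret u: group_hom "tensor_product M M" "tensor_product M M" "tau M T"
    by (intro group_homI tau_hom assms P.is_group)
  show ?thesis
    by (rule homI) (auto simp: P.m_ac P.inv_mult)
qed

lemma normal_one_minus_tau_image:
  assumes "comm_group M" "T \<in> hom M M"
  shows "one_minus_tau_image M T \<lhd> tensor_product M M"
proof -
  interpret P: comm_group "tensor_product M M"
    by (rule comm_group_tensor_product[OF assms(1) assms(1)])
  interpret v: group_hom "tensor_product M M" "tensor_product M M"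
      "\<lambda>t. t \<otimes>\<^bsub>tensor_product M M\<^esub> inv\<^bsub>tensor_product M M\<^esub> (tau M T t)"
    by (intro group_homI one_minus_tau_hom assms P.is_group)
  show ?thesis
    using v.img_is_subgroup by (simp add: P.normal_iff_subgroup one_minus_tau_image_def)
qed

lemma comm_group_S_group:
  assumes "comm_group M" "T \<in> hom M M"
  shows "comm_group (S_group M T)"
  unfolding S_group_eq
  by (intro comm_group.abelian_FactGroup comm_group_tensor_product assms normal_imp_subgroup
      normal_one_minus_tau_image)

section \<open>Twisted pairings and their universal property\<close>

text \<open>Bilinearity makes \<open>c\<close> factor through the tensor square of \<open>M\<close>;
  \<open>c_twist\<close> says that the induced map does not change under precomposition with
  \<open>tau M T\<close>. Such pairings thus correspond to homomorphisms from S(M,T) to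
  \<open>H\<close>. Two instances matter: the cocycle in \<pi>_1 and the classes in S(M,T)
  themselves.\<close>

locale twisted_pairing = M: comm_group M + H: comm_group H
  for M :: "('a, 'b) monoid_scheme" (structure)
    and T :: "'a \<Rightarrow> 'a"
    and H :: "('c, 'd) monoid_scheme" +
  fixes c :: "'a \<Rightarrow> 'a \<Rightarrow> 'c"
  assumes T_hom: "T \<in> hom M M"
    and c_closed [simp, intro]: "\<lbrakk>x \<in> carrier M; y \<in> carrier M\<rbrakk> \<Longrightarrow> c x y \<in> carrier H"
    and c_mult_left: "\<lbrakk>x \<in> carrier M; x' \<in> carrier M; y \<in> carrier M\<rbrakk>
      \<Longrightarrow> c (x \<otimes> x') y = c x y \<otimes>\<^bsub>H\<^esub> c x' y"
    and c_mult_right: "\<lbrakk>x \<in> carrier M; y \<in> carrier M; y' \<in> carrier M\<rbrakk>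
      \<Longrightarrow> c x (y \<otimes> y') = c x y \<otimes>\<^bsub>H\<^esub> c x y'"
    and c_twist: "\<lbrakk>x \<in> carrier M; y \<in> carrier M\<rbrakk> \<Longrightarrow> c (T y) x = c x y"
begin

lemma T_closed [simp, intro]: "x \<in> carrier M \<Longrightarrow> T x \<in> carrier M"
  using T_hom by (auto simp: hom_def)

lemma c_one_left [simp]: "y \<in> carrier M \<Longrightarrow> c \<one> y = \<one>\<^bsub>H\<^esub>"
  using c_mult_left[of \<one> \<one> y] H.l_cancel_one'[of "c \<one> y" "c \<one> y"] by simp

lemma c_one_right [simp]: "x \<in> carrier M \<Longrightarrow> c x \<one> = \<one>\<^bsub>H\<^esub>"
  using c_mult_right[of x \<one> \<one>] H.l_cancel_one'[of "c x \<one>" "c x \<one>"] by simp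

text \<open>The pairing is extended to the free abelian group on pairs and descends in two stages:
  first modulo the bilinear relators, then modulo the image of 1 - \<tau>. Invariance under \<tau>
  is tested on pure tensors, which generate.\<close>

lemma S_group_universal:
  obtains \<psi> where "\<psi> \<in> hom (S_group M T) H"
    "\<And>x y. \<lbrakk>x \<in> carrier M; y \<in> carrier M\<rbrakk> \<Longrightarrow> \<psi> (S_class M T x y) = c x y"
proof -
  let ?F = "free_Abelian_group (carrier M \<times> carrier M)" and ?P = "tensor_product M M"
  note M = M.comm_group_axioms
  obtain h where h: "h \<in> hom ?F H"
    "\<And>z. z \<in> carrier M \<times> carrier M \<Longrightarrow> h (frag_of z) = (case z of (x, y) \<Rightarrow> c x y)"
  proof (rule H.free_Abelian_group_universal[of "\<lambda>(x, y). c x y" "carrier M \<times> carrier M"])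
    show "(\<lambda>(x, y). c x y) ` (carrier M \<times> carrier M) \<subseteq> carrier H"
      by auto
  qed blast
  interpret h: group_hom ?F H h
    by (intro group_homI h(1) H.is_group group_free_Abelian_group)
  have minus: "h (a - b) = h a \<otimes>\<^bsub>H\<^esub> inv\<^bsub>H\<^esub> (h b)" if "a \<in> carrier ?F" "b \<in> carrier ?F" for a b
  proof -
    have "a - b = a \<otimes>\<^bsub>?F\<^esub> inv\<^bsub>?F\<^esub> b" using that by simp
    then show ?thesis using that by (simp only: h.hom_mult h.hom_inv h.G.inv_closed)
  qed
  \<comment> \<open>Both families of bilinear relators have the shape z - u - v, so a single
    computation treats them.\<close>
  have rel: "h (frag_of z - frag_of u - frag_of v) = \<one>\<^bsub>H\<^esub>"
    if "z \<in> carrier M \<times> carrier M" "u \<in> carrier M \<times> carrier M" "v \<in> carrier M \<times> carrier M"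
      "h (frag_of z) = h (frag_of u) \<otimes>\<^bsub>H\<^esub> h (frag_of v)" for z u v
  proof -
    have *: "frag_of z \<in> carrier ?F" "frag_of u \<in> carrier ?F" "frag_of v \<in> carrier ?F"
      using that by auto
    then have "frag_of z - frag_of u \<in> carrier ?F"
      using keys_diff[of "frag_of z" "frag_of u"] by auto
    then have "h (frag_of z - frag_of u - frag_of v) =
        h (frag_of u) \<otimes>\<^bsub>H\<^esub> h (frag_of v) \<otimes>\<^bsub>H\<^esub> inv\<^bsub>H\<^esub> h (frag_of u) \<otimes>\<^bsub>H\<^esub> inv\<^bsub>H\<^esub> h (frag_of v)"
      using * that(4) by (simp only: minus)
    also have "\<dots> = \<one>\<^bsub>H\<^esub>"
      using H.r_inv[of "h (frag_of u) \<otimes>\<^bsub>H\<^esub> h (frag_of v)"] h.hom_closed[OF *(2)] h.hom_closed[OF *(3)]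
      by (simp add: H.m_assoc H.inv_mult)
    finally show ?thesis .
  qed
  have "bilinear_rels M M \<subseteq> kernel ?F H h"
  proof
    fix r assume r: "r \<in> bilinear_rels M M"
    then have "h r = \<one>\<^bsub>H\<^esub>"
      unfolding bilinear_rels_def
      by (elim UnE CollectE exE conjE) (auto intro!: rel simp: h(2) c_mult_left c_mult_right)
    then show "r \<in> kernel ?F H h"
      using r bilinear_rels_subset[OF M M] unfolding kernel_def by blast
  qed
  then have "bilinear_subgroup M M \<subseteq> kernel ?F H h"
    unfolding bilinear_subgroup_def
    by (rule h.G.generate_subgroup_incl[OF _ h.subgroup_kernel])
  then have "h n = \<one>\<^bsub>H\<^esub>" if "n \<in> bilinear_subgroup M M" for n
    using that by (auto simp: kernel_def)
  from FactGroup_factor_through[OF normal_bilinear_subgroup[OF M M] H.is_group h(1) this]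
  obtain g where g: "g \<in> hom ?P H" "\<And>f. f \<in> carrier ?F \<Longrightarrow> g (tensor_coset M M f) = h f"
    unfolding tensor_product_def tensor_coset_def by blast
  have g_pure: "g (pure_tensor M M x y) = c x y" if "x \<in> carrier M" "y \<in> carrier M" for x y
    using that by (simp add: pure_tensor_def g(2) h(2))
  interpret P: comm_group ?P by (rule comm_group_tensor_product[OF M M])
  interpret g: group_hom ?P H g
    by (intro group_homI g(1) H.is_group P.is_group)
  have tau: "tau M T \<in> hom ?P ?P" by (rule tau_hom[OF M T_hom])
  interpret u: group_hom ?P ?P "tau M T"
    by (intro group_homI tau P.is_group)
  interpret q: group_hom ?F ?P "tensor_coset M M"
    by (rule group_hom_tensor_coset[OF M M])
  have "g (tau M T t) = g t" if "t \<in> carrier ?P" for t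
  proof -
    obtain f where f: "f \<in> carrier ?F" "t = tensor_coset M M f"
      using \<open>t \<in> carrier ?P\<close> by (rule tensor_product_carrierE)
    have "Poly_Mapping.keys f \<subseteq> carrier M \<times> carrier M" using f(1) by simp
    then have "g (tau M T (tensor_coset M M f)) = g (tensor_coset M M f)"
    proof (induction rule: free_Abelian_group_induct[consumes 1, case_names zero diff one])
      case zero
      have "tensor_coset M M 0 = \<one>\<^bsub>?P\<^esub>" using q.hom_one by simp
      then show ?case by (simp only: u.hom_one)
    next
      case (diff a b)
      then have a: "a \<in> carrier ?F" and b: "b \<in> carrier ?F" by auto
      have "a - b = a \<otimes>\<^bsub>?F\<^esub> inv\<^bsub>?F\<^esub> b" using b by simp
      then have "tensor_coset M M (a - b) = tensor_coset M M a \<otimes>\<^bsub>?P\<^esub> inv\<^bsub>?P\<^esub> (tensor_coset M M b)"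
        using a b by (metis h.G.inv_closed q.hom_inv q.hom_mult)
      then show ?case
        using diff q.hom_closed[OF a] q.hom_closed[OF b] by simp
    next
      case (one z)
      then show ?case
        using tau_pure_tensor[OF M T_hom] g_pure c_twist
        by (cases z) (auto simp: pure_tensor_def[symmetric])
    qed
    then show ?thesis using f(2) by simp
  qed
  then have "g n = \<one>\<^bsub>H\<^esub>" if "n \<in> one_minus_tau_image M T" for n
    using that by (auto simp: one_minus_tau_image_def)
  from FactGroup_factor_through[OF normal_one_minus_tau_image[OF M T_hom] H.is_group g(1) this]
  obtain \<psi> where psi: "\<psi> \<in> hom (S_group M T) H"
    "\<And>t. t \<in> carrier ?P \<Longrightarrow> \<psi> (one_minus_tau_image M T #>\<^bsub>?P\<^esub> t) = g t"
    unfolding S_group_eq by blast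
  have "pure_tensor M M x y \<in> carrier ?P" if "x \<in> carrier M" "y \<in> carrier M" for x y
    unfolding pure_tensor_def using that by (intro q.hom_closed) simp
  with psi g_pure that show thesis
    by (simp add: S_class_def)
qed

end

lemma group_hom_S_quotient:
  assumes "comm_group M" "T \<in> hom M M"
  shows "group_hom (tensor_product M M) (S_group M T)
    (\<lambda>t. one_minus_tau_image M T #>\<^bsub>tensor_product M M\<^esub> t)"
proof (rule group_homI)
  show "(\<lambda>t. one_minus_tau_image M T #>\<^bsub>tensor_product M M\<^esub> t)
      \<in> hom (tensor_product M M) (S_group M T)"
    unfolding S_group_eq by (rule normal.r_coset_hom_Mod[OF normal_one_minus_tau_image[OF assms]])
qed (simp_all add: comm_group.axioms(2) comm_group_S_group comm_group_tensor_product assms)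

lemma group_hom_S_projection:
  assumes "comm_group M" "T \<in> hom M M"
  shows "group_hom (free_Abelian_group (carrier M \<times> carrier M)) (S_group M T)
    (\<lambda>f. one_minus_tau_image M T #>\<^bsub>tensor_product M M\<^esub> tensor_coset M M f)"
proof -
  interpret q: group_hom "free_Abelian_group (carrier M \<times> carrier M)" "tensor_product M M" "tensor_coset M M"
    by (rule group_hom_tensor_coset[OF assms(1) assms(1)])
  interpret p: group_hom "tensor_product M M" "S_group M T"
      "\<lambda>t. one_minus_tau_image M T #>\<^bsub>tensor_product M M\<^esub> t"
    by (rule group_hom_S_quotient[OF assms])
  show ?thesis
    using group_homI[OF q.G.is_group p.H.is_group hom_compose[OF q.homh p.homh]]
    by (simp add: comp_def)
qed

text \<open>The classes of pure tensors generate S(M,T). This reduces the identity for \<rho> after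
  \<psi> to a check on generators.\<close>

lemma S_group_hom_unique:
  assumes "comm_group M" "T \<in> hom M M" "group H"
    and "h \<in> hom (S_group M T) H" "k \<in> hom (S_group M T) H"
    and eq: "\<And>x y. \<lbrakk>x \<in> carrier M; y \<in> carrier M\<rbrakk> \<Longrightarrow> h (S_class M T x y) = k (S_class M T x y)"
    and s: "s \<in> carrier (S_group M T)"
  shows "h s = k s"
proof -
  let ?F = "free_Abelian_group (carrier M \<times> carrier M)"
  let ?q = "\<lambda>f. one_minus_tau_image M T #>\<^bsub>tensor_product M M\<^esub> tensor_coset M M f"
  interpret q: group_hom ?F "S_group M T" ?q
    by (rule group_hom_S_projection[OF assms(1,2)])
  interpret h: group_hom "S_group M T" H h
    by (rule group_homI[OF q.H.is_group assms(3,4)])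
  interpret k: group_hom "S_group M T" H k
    by (rule group_homI[OF q.H.is_group assms(3,5)])
  obtain t where t: "t \<in> carrier (tensor_product M M)"
    "s = one_minus_tau_image M T #>\<^bsub>tensor_product M M\<^esub> t"
    using s unfolding S_group_eq carrier_FactGroup by blast
  obtain f where f: "f \<in> carrier ?F" "t = tensor_coset M M f"
    using t(1) by (rule tensor_product_carrierE)
  have "Poly_Mapping.keys f \<subseteq> carrier M \<times> carrier M" using f(1) by simp
  then have "h (?q f) = k (?q f)"
  proof (induction rule: free_Abelian_group_induct[consumes 1, case_names zero diff one])
    case zero
    have "?q 0 = \<one>\<^bsub>S_group M T\<^esub>" using q.hom_one by simp
    then show ?case by (simp only: h.hom_one k.hom_one)
  next
    case (diff a b)
    then have a: "a \<in> carrier ?F" and b: "b \<in> carrier ?F" by auto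
    have "a - b = a \<otimes>\<^bsub>?F\<^esub> inv\<^bsub>?F\<^esub> b" using b by simp
    then have "?q (a - b) = ?q a \<otimes>\<^bsub>S_group M T\<^esub> inv\<^bsub>S_group M T\<^esub> (?q b)"
      using a b by (metis q.G.inv_closed q.hom_inv q.hom_mult)
    then show ?case
      using diff q.hom_closed[OF a] q.hom_closed[OF b] by simp
  next
    case (one z)
    then show ?case
      using eq[of "fst z" "snd z"] by (auto simp: pure_tensor_def S_class_def)
  qed
  then show ?thesis using f(2) t(2) by simp
qed

text \<open>The universal instance: bilinearity holds because the relators were divided out in the
  tensor product, and the twist holds because t - \<tau>(t) lies in the image of 1 - \<tau> for each
  pure tensor t.\<close>

lemma twisted_pairing_S_class:
  assumes "comm_group M" "T \<in> hom M M"
  shows "twisted_pairing M T (S_group M T) (S_class M T)"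
proof -
  let ?F = "free_Abelian_group (carrier M \<times> carrier M)" and ?P = "tensor_product M M"
  let ?I = "one_minus_tau_image M T" and ?B = "bilinear_subgroup M M"
  interpret M: comm_group M by fact
  interpret S: comm_group "S_group M T" by (rule comm_group_S_group[OF assms])
  interpret q: group_hom ?F ?P "tensor_coset M M"
    by (rule group_hom_tensor_coset[OF assms(1) assms(1)])
  interpret p: group_hom ?P "S_group M T" "\<lambda>t. ?I #>\<^bsub>?P\<^esub> t"
    by (rule group_hom_S_quotient[OF assms])
  interpret I: normal ?I ?P by (rule normal_one_minus_tau_image[OF assms])
  interpret B: normal ?B ?F by (rule normal_bilinear_subgroup[OF assms(1) assms(1)])
  interpret u: group_hom ?P ?P "tau M T"
    by (intro group_homI tau_hom assms q.H.is_group)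
  have pure: "pure_tensor M M x y \<in> carrier ?P" if "x \<in> carrier M" "y \<in> carrier M" for x y
    unfolding pure_tensor_def using that by (intro q.hom_closed) simp
  have rel: "tensor_coset M M (frag_of z) = tensor_coset M M (frag_of v) \<otimes>\<^bsub>?P\<^esub> tensor_coset M M (frag_of w)"
    if "frag_of z - frag_of v - frag_of w \<in> bilinear_rels M M"
      "z \<in> carrier M \<times> carrier M" "v \<in> carrier M \<times> carrier M" "w \<in> carrier M \<times> carrier M" for z v w
  proof -
    let ?r = "frag_of z - frag_of v - frag_of w"
    have r: "?r \<in> ?B"
      using that(1) by (simp add: bilinear_subgroup_def generate.incl)
    have vw: "frag_of v \<otimes>\<^bsub>?F\<^esub> frag_of w \<in> carrier ?F"
      using that(3,4) by (intro q.G.m_closed) (simp_all only: frag_of_in_free_Abelian_group)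
    have "frag_of z = ?r \<otimes>\<^bsub>?F\<^esub> (frag_of v \<otimes>\<^bsub>?F\<^esub> frag_of w)" by simp
    then have "frag_of z \<in> ?B #>\<^bsub>?F\<^esub> (frag_of v \<otimes>\<^bsub>?F\<^esub> frag_of w)"
      unfolding r_coset_def using r by blast
    then have "tensor_coset M M (frag_of z) = tensor_coset M M (frag_of v \<otimes>\<^bsub>?F\<^esub> frag_of w)"
      unfolding tensor_coset_def
      using q.G.repr_independence[OF _ vw B.subgroup_axioms] by metis
    then show ?thesis
      using q.hom_mult[of "frag_of v" "frag_of w"] that(3,4) by (simp only: frag_of_in_free_Abelian_group)
  qed
  show ?thesis
  proof
    fix x y assume xy: "x \<in> carrier M" "y \<in> carrier M"
    show "S_class M T x y \<in> carrier (S_group M T)"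
      unfolding S_class_def by (rule p.hom_closed[OF pure[OF xy]])
    let ?t = "pure_tensor M M x y"
    have "?t \<otimes>\<^bsub>?P\<^esub> inv\<^bsub>?P\<^esub> tau M T ?t \<in> ?I"
      unfolding one_minus_tau_image_def using pure[OF xy] by blast
    \<comment> \<open>Writing t as (t - \<tau>(t)) + \<tau>(t) puts t into the coset of \<tau>(t),
      so the two cosets coincide.\<close>
    then have "(?t \<otimes>\<^bsub>?P\<^esub> inv\<^bsub>?P\<^esub> tau M T ?t) \<otimes>\<^bsub>?P\<^esub> tau M T ?t \<in> ?I #>\<^bsub>?P\<^esub> tau M T ?t"
      unfolding r_coset_def by blast
    then have "?t \<in> ?I #>\<^bsub>?P\<^esub> tau M T ?t"
      using pure[OF xy] by (simp add: q.H.m_assoc)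
    then have "?I #>\<^bsub>?P\<^esub> ?t = ?I #>\<^bsub>?P\<^esub> tau M T ?t"
      using q.H.repr_independence[OF _ _ I.subgroup_axioms] pure[OF xy] by (metis u.hom_closed)
    then show "S_class M T (T y) x = S_class M T x y"
      by (simp add: S_class_def tau_pure_tensor[OF assms xy])
  next
    fix x x' y assume xy: "x \<in> carrier M" "x' \<in> carrier M" "y \<in> carrier M"
    have "pure_tensor M M (x \<otimes>\<^bsub>M\<^esub> x') y = pure_tensor M M x y \<otimes>\<^bsub>?P\<^esub> pure_tensor M M x' y"
      unfolding pure_tensor_def
    proof (rule rel)
      show "frag_of (x \<otimes>\<^bsub>M\<^esub> x', y) - frag_of (x, y) - frag_of (x', y) \<in> bilinear_rels M M"
        unfolding bilinear_rels_def using xy by blast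
    qed (use xy in auto)
    then show "S_class M T (x \<otimes>\<^bsub>M\<^esub> x') y = S_class M T x y \<otimes>\<^bsub>S_group M T\<^esub> S_class M T x' y"
      using pure xy by (simp add: S_class_def)
  next
    fix x y y' assume xy: "x \<in> carrier M" "y \<in> carrier M" "y' \<in> carrier M"
    have "pure_tensor M M x (y \<otimes>\<^bsub>M\<^esub> y') = pure_tensor M M x y \<otimes>\<^bsub>?P\<^esub> pure_tensor M M x y'"
      unfolding pure_tensor_def
    proof (rule rel)
      show "frag_of (x, y \<otimes>\<^bsub>M\<^esub> y') - frag_of (x, y) - frag_of (x, y') \<in> bilinear_rels M M"
        unfolding bilinear_rels_def using xy by blast
    qed (use xy in auto)
    then show "S_class M T x (y \<otimes>\<^bsub>M\<^esub> y') = S_class M T x y \<otimes>\<^bsub>S_group M T\<^esub> S_class M T x y'"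
      using pure xy by (simp add: S_class_def)
  qed (fact assms)
qed

section \<open>Adjoint groups\<close>

lemma adj_gen_closed [simp, intro]: "x \<in> carrier Q \<Longrightarrow> adj_gen Q x \<in> carrier (Adj Q)"
  unfolding adj_gen_def Adj_def by (rule presented_group_classI) simp

lemma inv_adj_gen:
  assumes "x \<in> carrier Q"
  shows "inv\<^bsub>Adj Q\<^esub> (adj_gen Q x) = pres_cong (carrier Q) (adj_rels Q) `` {[(x, False)]}"
proof -
  interpret A: group "Adj Q" by (rule group_Adj)
  have l: "[(x, b)] \<in> lists (carrier Q \<times> UNIV)" for b
    using assms by simp
  have "pres_cong (carrier Q) (adj_rels Q) `` {[(x, False)] @ [(x, True)]} = \<one>\<^bsub>Adj Q\<^esub>"
    using pres_cong.cancel[OF assms, where b = False and R = "adj_rels Q"]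
    by (simp add: Adj_def one_presented_group equiv_class_eq[OF equiv_pres_cong])
  then have "pres_cong (carrier Q) (adj_rels Q) `` {[(x, False)]} \<otimes>\<^bsub>Adj Q\<^esub> adj_gen Q x = \<one>\<^bsub>Adj Q\<^esub>"
    by (simp only: Adj_def adj_gen_def mult_presented_group[OF l l])
  then show ?thesis
    using presented_group_classI[OF l[of False], of "adj_rels Q"] assms
    by (metis A.inv_equality Adj_def adj_gen_closed)
qed

lemma Adj_induct [consumes 1, case_names one mult mult_inv]:
  assumes "g \<in> carrier (Adj Q)"
    and "P \<one>\<^bsub>Adj Q\<^esub>"
    and mult: "\<And>g x. \<lbrakk>g \<in> carrier (Adj Q); x \<in> carrier Q; P g\<rbrakk> \<Longrightarrow> P (g \<otimes>\<^bsub>Adj Q\<^esub> adj_gen Q x)"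
    and mult_inv: "\<And>g x. \<lbrakk>g \<in> carrier (Adj Q); x \<in> carrier Q; P g\<rbrakk>
      \<Longrightarrow> P (g \<otimes>\<^bsub>Adj Q\<^esub> inv\<^bsub>Adj Q\<^esub> (adj_gen Q x))"
  shows "P g"
proof -
  let ?c = "\<lambda>w. pres_cong (carrier Q) (adj_rels Q) `` {w}"
  have "P (?c w)" if "w \<in> lists (carrier Q \<times> UNIV)" for w
    using that
  proof (induction w rule: rev_induct)
    case Nil
    then show ?case using assms(2) by (simp add: Adj_def one_presented_group)
  next
    case (snoc a w)
    obtain x b where a: "a = (x, b)" by force
    have x: "x \<in> carrier Q" and w: "w \<in> lists (carrier Q \<times> UNIV)"
      and l: "[(x, b)] \<in> lists (carrier Q \<times> UNIV)"
      using snoc.prems a by auto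
    have "?c (w @ [a]) = ?c w \<otimes>\<^bsub>Adj Q\<^esub> ?c [(x, b)]"
      unfolding a Adj_def by (rule mult_presented_group[OF w l, symmetric])
    moreover have "?c w \<in> carrier (Adj Q)"
      unfolding Adj_def by (rule presented_group_classI[OF w])
    ultimately show ?case
      using mult[OF _ x snoc.IH[OF w]] mult_inv[OF _ x snoc.IH[OF w]] inv_adj_gen[OF x]
      by (cases b) (auto simp: adj_gen_def)
  qed
  then show ?thesis
    using assms(1) unfolding Adj_def by (metis carrier_presented_groupE)
qed

text \<open>An equivalence in the induction step also covers inverse generators: it is applied to g
  times the inverse of a generator, whose product with that generator is g again. Later inductions
  therefore treat positive generators only.\<close>

lemma Adj_induct_iff [consumes 1, case_names one mult]:
  assumes "g \<in> carrier (Adj Q)"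
    and "P \<one>\<^bsub>Adj Q\<^esub>"
    and iff: "\<And>g x. \<lbrakk>g \<in> carrier (Adj Q); x \<in> carrier Q\<rbrakk> \<Longrightarrow> P (g \<otimes>\<^bsub>Adj Q\<^esub> adj_gen Q x) \<longleftrightarrow> P g"
  shows "P g"
  using assms(1)
proof (induction rule: Adj_induct)
  case (mult_inv g x)
  interpret A: group "Adj Q" by (rule group_Adj)
  show ?case
    using iff[of "g \<otimes>\<^bsub>Adj Q\<^esub> inv\<^bsub>Adj Q\<^esub> (adj_gen Q x)" x] mult_inv by (simp add: A.m_assoc)
qed (simp_all add: assms)

context quandle
begin

sublocale A: group "Adj Q"
  by (rule group_Adj)

lemma adj_gen_relation:
  assumes "x \<in> carrier Q" "y \<in> carrier Q"
  shows "adj_gen Q y \<otimes>\<^bsub>Adj Q\<^esub> adj_gen Q x = adj_gen Q x \<otimes>\<^bsub>Adj Q\<^esub> adj_gen Q (y \<star> x)"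
proof -
  let ?c = "\<lambda>w. pres_cong (carrier Q) (adj_rels Q) `` {w}"
  have l: "[(x, False)] \<in> lists (carrier Q \<times> UNIV)" "[(y, True), (x, True)] \<in> lists (carrier Q \<times> UNIV)"
    "[(y, True)] \<in> lists (carrier Q \<times> UNIV)" "[(x, True)] \<in> lists (carrier Q \<times> UNIV)"
    using assms by auto
  have "([(y \<star> x, True)], [(x, False), (y, True), (x, True)]) \<in> pres_cong (carrier Q) (adj_rels Q)"
    using assms by (intro pres_cong.rel) (auto simp: adj_rels_def qop_closed)
  then have "adj_gen Q (y \<star> x) = ?c ([(x, False)] @ [(y, True), (x, True)])"
    unfolding adj_gen_def using equiv_class_eq[OF equiv_pres_cong] by simp
  also have "\<dots> = inv\<^bsub>Adj Q\<^esub> (adj_gen Q x) \<otimes>\<^bsub>Adj Q\<^esub> ?c ([(y, True)] @ [(x, True)])"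
    using mult_presented_group[OF l(1,2), of "adj_rels Q"] inv_adj_gen[OF assms(1)] by (simp add: Adj_def)
  also have "?c ([(y, True)] @ [(x, True)]) = adj_gen Q y \<otimes>\<^bsub>Adj Q\<^esub> adj_gen Q x"
    unfolding adj_gen_def Adj_def by (rule mult_presented_group[OF l(3,4), symmetric])
  finally show ?thesis
    using assms by (simp add: A.m_assoc[symmetric])
qed

text \<open>The defining relation extends from generators to all g: conjugation by g permutes the
  generators in the way g acts on the quandle.\<close>

lemma adj_gen_conj:
  assumes "g \<in> carrier (Adj Q)" "p \<in> carrier Q"
  shows "adj_gen Q p \<otimes>\<^bsub>Adj Q\<^esub> g = g \<otimes>\<^bsub>Adj Q\<^esub> adj_gen Q (adj_act Q p g)"
  using assms(1)
proof (induction rule: Adj_induct_iff)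
  case one
  then show ?case using assms(2) by (simp add: adj_act_one)
next
  case (mult g x)
  let ?r = "adj_act Q p g"
  have r: "?r \<in> carrier Q" using mult assms(2) by (simp add: adj_act_closed)
  \<comment> \<open>The defining relation for \<open>?r\<close> and \<open>x\<close> pulls
    \<open>adj_gen Q x\<close> to the right end. Cancelling it makes the claim for the longer
    product equivalent to the claim for \<open>g\<close>.\<close>
  have "g \<otimes>\<^bsub>Adj Q\<^esub> adj_gen Q x \<otimes>\<^bsub>Adj Q\<^esub> adj_gen Q (?r \<star> x) = g \<otimes>\<^bsub>Adj Q\<^esub> adj_gen Q ?r \<otimes>\<^bsub>Adj Q\<^esub> adj_gen Q x"
    using mult r by (simp add: adj_gen_relation[of x ?r] qop_closed A.m_assoc)
  moreover have "adj_act Q p (g \<otimes>\<^bsub>Adj Q\<^esub> adj_gen Q x) = ?r \<star> x"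
    using mult r assms(2) by (simp add: adj_act_mult adj_act_gen)
  ultimately show ?case
    using mult r assms(2) by (simp add: A.m_assoc[symmetric])
qed

text \<open>If g fixes every point, \<open>adj_gen_conj\<close> says that g commutes with every
  generator.\<close>

lemma trivial_action_central:
  assumes g: "g \<in> carrier (Adj Q)" "\<And>p. p \<in> carrier Q \<Longrightarrow> adj_act Q p g = p"
    and h: "h \<in> carrier (Adj Q)"
  shows "h \<otimes>\<^bsub>Adj Q\<^esub> g = g \<otimes>\<^bsub>Adj Q\<^esub> h"
  using h
proof (induction rule: Adj_induct_iff)
  case one
  then show ?case using g by simp
next
  case (mult h x)
  have "h \<otimes>\<^bsub>Adj Q\<^esub> adj_gen Q x \<otimes>\<^bsub>Adj Q\<^esub> g = h \<otimes>\<^bsub>Adj Q\<^esub> g \<otimes>\<^bsub>Adj Q\<^esub> adj_gen Q x"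
    using adj_gen_conj[OF g(1) mult(2)] g mult by (simp add: A.m_assoc)
  then show ?case
    using mult g(1) by (simp add: A.m_assoc[symmetric])
qed

end

section \<open>Actions of the adjoint group prescribed on generators\<close>

text \<open>\<open>F_rel\<close> is the defining relation with its inverse letter cleared, read as a
  right action: acting by \<open>x\<close> and then by \<open>y \<star> x\<close> equals acting by
  \<open>y\<close> and then by \<open>x\<close>. Such bijections of an arbitrary set
  \<open>X\<close> therefore extend to a right action of the adjoint group.\<close>

locale adj_action = quandle Q for Q :: "('a, 'b) quandle_struct_scheme" (structure) +
  fixes X :: "'c set" and F :: "'a \<Rightarrow> 'c \<Rightarrow> 'c"
  assumes F_bij: "x \<in> carrier Q \<Longrightarrow> bij_betw (F x) X X"
    and F_rel: "\<lbrakk>x \<in> carrier Q; y \<in> carrier Q; p \<in> X\<rbrakk> \<Longrightarrow> F (y \<star> x) (F x p) = F x (F y p)"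
begin

definition letter :: "'c \<Rightarrow> 'a \<times> bool \<Rightarrow> 'c" where
  "letter p = (\<lambda>(x, b). if b then F x p else inv_into X (F x) p)"

definition act :: "'c \<Rightarrow> 'a word set \<Rightarrow> 'c" where
  "act p g = the_elem (foldl letter p ` g)"

lemma F_closed: "\<lbrakk>x \<in> carrier Q; p \<in> X\<rbrakk> \<Longrightarrow> F x p \<in> X"
  using F_bij by (auto simp: bij_betw_def)

lemma foldl_letter_closed:
  "w \<in> lists (carrier Q \<times> UNIV) \<Longrightarrow> p \<in> X \<Longrightarrow> foldl letter p w \<in> X"
proof (induction w arbitrary: p)
  case (Cons a w)
  then have "letter p a \<in> X"
    using F_bij[of "fst a"] F_closed
    by (auto simp: letter_def bij_betw_def intro!: inv_into_into)
  with Cons show ?case by simp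
qed simp

lemma foldl_letter_cong:
  "(u, v) \<in> pres_cong (carrier Q) (adj_rels Q) \<Longrightarrow> p \<in> X \<Longrightarrow> foldl letter p u = foldl letter p v"
proof (induction arbitrary: p rule: pres_cong.induct)
  case (append u u' v v')
  then show ?case
    using foldl_letter_closed pres_cong_subset by (metis foldl_append)
next
  case (cancel x b)
  then show ?case
    using bij_betw_inv_into_left[OF F_bij[of x]] bij_betw_inv_into_right[OF F_bij[of x]]
    by (cases b) (auto simp: letter_def)
next
  case (rel u v)
  then obtain x y where x: "x \<in> carrier Q" and y: "y \<in> carrier Q"
    and u: "u = [(y \<star> x, True)]" and v: "v = [(x, False), (y, True), (x, True)]"
    by (auto simp: adj_rels_def)
  \<comment> \<open>Since \<open>F x\<close> is onto, the point has the form \<open>F x r\<close>;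
    the leading inverse letter of \<open>v\<close> takes it back to \<open>r\<close>.\<close>
  obtain r where r: "r \<in> X" "p = F x r"
    using F_bij[OF x] \<open>p \<in> X\<close> by (auto simp: bij_betw_def)
  then show ?case
    using F_rel[OF x y r(1)] bij_betw_inv_into_left[OF F_bij[OF x]] by (simp add: u v letter_def)
qed auto

lemma act_class:
  "w \<in> lists (carrier Q \<times> UNIV) \<Longrightarrow> p \<in> X \<Longrightarrow>
    act p (pres_cong (carrier Q) (adj_rels Q) `` {w}) = foldl letter p w"
  unfolding act_def by (rule the_elem_pres_cong) (auto dest: foldl_letter_cong)

lemma act_closed [simp, intro]: "g \<in> carrier (Adj Q) \<Longrightarrow> p \<in> X \<Longrightarrow> act p g \<in> X"
  unfolding Adj_def
  by (elim carrier_presented_groupE) (metis act_class foldl_letter_closed)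

lemma act_gen [simp]: "x \<in> carrier Q \<Longrightarrow> p \<in> X \<Longrightarrow> act p (adj_gen Q x) = F x p"
  unfolding adj_gen_def by (subst act_class) (auto simp: letter_def)

lemma act_one [simp]: "p \<in> X \<Longrightarrow> act p \<one>\<^bsub>Adj Q\<^esub> = p"
  by (simp add: Adj_def one_presented_group act_class)

lemma act_mult:
  assumes "g \<in> carrier (Adj Q)" "h \<in> carrier (Adj Q)" "p \<in> X"
  shows "act p (g \<otimes>\<^bsub>Adj Q\<^esub> h) = act (act p g) h"
proof -
  obtain u v where u: "u \<in> lists (carrier Q \<times> UNIV)" "g = pres_cong (carrier Q) (adj_rels Q) `` {u}"
    and v: "v \<in> lists (carrier Q \<times> UNIV)" "h = pres_cong (carrier Q) (adj_rels Q) `` {v}"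
    using assms unfolding Adj_def by (elim carrier_presented_groupE)
  have uv: "u @ v \<in> lists (carrier Q \<times> UNIV)" using u(1) v(1) by simp
  show ?thesis
    by (simp only: u(2) v(2) Adj_def mult_presented_group[OF u(1) v(1)]
        act_class[OF u(1) assms(3)] act_class[OF uv assms(3)]
        act_class[OF v(1) foldl_letter_closed[OF u(1) assms(3)]] foldl_append)
qed

lemma act_inv_gen:
  assumes "x \<in> carrier Q" "p \<in> X"
  shows "act (F x p) (inv\<^bsub>Adj Q\<^esub> (adj_gen Q x)) = p"
  using act_mult[of "adj_gen Q x" "inv\<^bsub>Adj Q\<^esub> (adj_gen Q x)" p] assms by simp

end

section \<open>The adjoint group of an Alexander quandle\<close>

locale alexander = M: comm_group M for M :: "('a, 'b) monoid_scheme" (structure) +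
  fixes T :: "'a \<Rightarrow> 'a"
  assumes T_iso: "T \<in> iso M M"
    and one_minus_T_iso: "(\<lambda>x. x \<otimes> inv (T x)) \<in> iso M M"
begin

abbreviation "Q \<equiv> alexander_quandle M T"

abbreviation adj_mult (infixl "\<cdot>" 70) where "g \<cdot> h \<equiv> g \<otimes>\<^bsub>Adj Q\<^esub> h"

abbreviation adj_inv where "adj_inv g \<equiv> inv\<^bsub>Adj Q\<^esub> g"

abbreviation e where "e x \<equiv> adj_gen Q x"

abbreviation "\<pi> \<equiv> fundamental_group Q \<one>"

definition D where "D x = x \<otimes> inv (T x)"

lemma T_hom: "T \<in> hom M M" and T_bij: "bij_betw T (carrier M) (carrier M)"
  using T_iso by (auto simp: iso_def)

lemma D_hom: "D \<in> hom M M" and D_bij: "bij_betw D (carrier M) (carrier M)"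
  using one_minus_T_iso by (auto simp: iso_def D_def[abs_def])

sublocale T: group_hom M M T
  by (intro group_homI T_hom M.is_group)

sublocale D: group_hom M M D
  by (intro group_homI D_hom M.is_group)

sublocale Q: quandle Q
  by (intro quandle_alexander_quandle M.comm_group_axioms T_iso)

lemma T_inj: "\<lbrakk>x \<in> carrier M; y \<in> carrier M\<rbrakk> \<Longrightarrow> T x = T y \<longleftrightarrow> x = y"
  using T_bij by (auto simp: bij_betw_def inj_on_def)

lemma D_eq_one: "x \<in> carrier M \<Longrightarrow> D x = \<one> \<longleftrightarrow> x = \<one>"
  using inj_on_eq_iff[OF bij_betw_imp_inj_on[OF D_bij], of x \<one>] by simp

lemma carrier_Q [simp]: "carrier Q = carrier M"
  by (simp add: alexander_quandle_def)

lemma qop_Q: "\<lbrakk>x \<in> carrier M; y \<in> carrier M\<rbrakk> \<Longrightarrow> y \<star>\<^bsub>Q\<^esub> x = T y \<otimes> D x"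
  by (simp add: alexander_quandle_def D_def M.m_assoc)

lemma D_mult_T: "x \<in> carrier M \<Longrightarrow> D x \<otimes> T x = x"
  by (simp add: D_def M.m_assoc)

lemma e_closed [simp, intro]: "x \<in> carrier M \<Longrightarrow> e x \<in> carrier (Adj Q)"
  by simp

lemma cancel_inv [simp]:
  assumes "g \<in> carrier (Adj Q)" "h \<in> carrier (Adj Q)"
  shows "adj_inv g \<cdot> (g \<cdot> h) = h" "g \<cdot> (adj_inv g \<cdot> h) = h"
  using assms by (simp_all add: Q.A.m_assoc[symmetric])

lemma adj_act_closed [simp, intro]:
  "\<lbrakk>g \<in> carrier (Adj Q); p \<in> carrier M\<rbrakk> \<Longrightarrow> adj_act Q p g \<in> carrier M"
  using Q.adj_act_closed by simp

lemma adj_act_mult [simp]: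
  "\<lbrakk>g \<in> carrier (Adj Q); h \<in> carrier (Adj Q); p \<in> carrier M\<rbrakk>
    \<Longrightarrow> adj_act Q p (g \<cdot> h) = adj_act Q (adj_act Q p g) h"
  using Q.adj_act_mult by simp

lemma adj_act_one [simp]: "p \<in> carrier M \<Longrightarrow> adj_act Q p \<one>\<^bsub>Adj Q\<^esub> = p"
  using Q.adj_act_one by simp

lemma adj_act_e [simp]: "\<lbrakk>x \<in> carrier M; p \<in> carrier M\<rbrakk> \<Longrightarrow> adj_act Q p (e x) = T p \<otimes> D x"
  using Q.adj_act_gen by (simp add: qop_Q)

sublocale eps: group_hom "Adj Q" integer_group adj_eps
  by (intro group_homI group_Adj group_integer_group adj_eps_hom)

lemma adj_eps_mult [simp]:
  "\<lbrakk>g \<in> carrier (Adj Q); h \<in> carrier (Adj Q)\<rbrakk> \<Longrightarrow> adj_eps (g \<cdot> h) = adj_eps g + adj_eps h"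
  by simp

lemma adj_eps_e [simp]: "x \<in> carrier M \<Longrightarrow> adj_eps (e x) = 1"
  by (simp add: adj_eps_gen)

lemma adj_eps_inv [simp]: "g \<in> carrier (Adj Q) \<Longrightarrow> adj_eps (adj_inv g) = - adj_eps g"
  using eps.hom_inv by simp

lemma adj_eps_one [simp]: "adj_eps \<one>\<^bsub>Adj Q\<^esub> = 0"
  using eps.hom_one by simp

lemma e_one_pow_Suc: "e \<one> [^]\<^bsub>Adj Q\<^esub> (n + 1 :: int) = e \<one> [^]\<^bsub>Adj Q\<^esub> n \<cdot> e \<one>"
  using Q.A.int_pow_mult[of "e \<one>" n 1] by (simp add: Q.A.int_pow_1)

text \<open>The power of \<open>e \<one>\<close> acts on \<open>p\<close> as the corresponding power of \<open>T\<close>.\<close>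

lemma adj_act_affine:
  assumes "g \<in> carrier (Adj Q)" "p \<in> carrier M"
  shows "adj_act Q p g = adj_act Q p (e \<one> [^]\<^bsub>Adj Q\<^esub> adj_eps g) \<otimes> adj_act Q \<one> g"
  using assms(1)
proof (induction rule: Adj_induct_iff)
  case one
  then show ?case using assms(2) by simp
next
  case (mult g x)
  let ?q = "adj_act Q p (e \<one> [^]\<^bsub>Adj Q\<^esub> adj_eps g)"
  have q: "?q \<in> carrier M" using assms(2) by simp
  have "adj_act Q p (g \<cdot> e x) = T (adj_act Q p g) \<otimes> D x"
    using mult assms(2) by simp
  moreover have "adj_act Q p (e \<one> [^]\<^bsub>Adj Q\<^esub> adj_eps (g \<cdot> e x)) \<otimes> adj_act Q \<one> (g \<cdot> e x)
      = T (?q \<otimes> adj_act Q \<one> g) \<otimes> D x"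
    using mult assms(2) q by (simp add: e_one_pow_Suc M.m_assoc)
  ultimately show ?case
    using mult assms(2) q by (simp add: T_inj del: T.hom_mult)
qed

lemma carrier_pi: "carrier \<pi> = {g \<in> carrier (Adj Q). adj_eps g = 0 \<and> adj_act Q \<one> g = \<one>}"
  by (auto simp: fundamental_group_def kernel_def)

lemma pi_mult [simp]: "g \<otimes>\<^bsub>\<pi>\<^esub> h = g \<cdot> h"
  by (simp add: fundamental_group_def)

lemma pi_closed [simp, intro]: "g \<in> carrier \<pi> \<Longrightarrow> g \<in> carrier (Adj Q)"
  by (simp add: carrier_pi)

text \<open>In \<open>adj_act_affine\<close>, degree 0 makes the linear part the identity and fixing
  \<open>\<one>\<close> removes the translation part.\<close>

lemma pi_central:
  assumes "z \<in> carrier \<pi>" "g \<in> carrier (Adj Q)"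
  shows "g \<cdot> z = z \<cdot> g"
proof (rule Q.trivial_action_central[OF _ _ assms(2)])
  show "z \<in> carrier (Adj Q)" using assms(1) by simp
  show "adj_act Q p z = p" if "p \<in> carrier Q" for p
    using adj_act_affine[of z p] assms(1) that by (simp add: carrier_pi del: pi_closed)
qed

sublocale pi: comm_group \<pi>
proof (rule group.group_comm_groupI)
  show "group \<pi>"
    using Q.group_fundamental_group[of \<one>] by simp
  show "x \<otimes>\<^bsub>\<pi>\<^esub> y = y \<otimes>\<^bsub>\<pi>\<^esub> x" if "x \<in> carrier \<pi>" "y \<in> carrier \<pi>" for x y
    using pi_central that by simp
qed

section \<open>The cocycle \<open>c\<close> and its biadditivity\<close>

definition a where "a x = adj_inv (e \<one>) \<cdot> e x"

definition c where "c x y = adj_inv (a (x \<otimes> y)) \<cdot> (a x \<cdot> a y)"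

lemma a_closed [simp, intro]: "x \<in> carrier M \<Longrightarrow> a x \<in> carrier (Adj Q)"
  by (simp add: a_def)

lemma adj_eps_a [simp]: "x \<in> carrier M \<Longrightarrow> adj_eps (a x) = 0"
  by (simp add: a_def)

lemma a_one [simp]: "a \<one> = \<one>\<^bsub>Adj Q\<^esub>"
  by (simp add: a_def)

lemma e_eq: "x \<in> carrier M \<Longrightarrow> e x = e \<one> \<cdot> a x"
  by (simp add: a_def)

text \<open>Since \<open>D \<one> = \<one>\<close>, the generator \<open>e \<one>\<close> acts as
  \<open>T\<close>, so its inverse acts as the inverse of \<open>T\<close>.\<close>

lemma T_adj_act_inv_e_one:
  "p \<in> carrier M \<Longrightarrow> T (adj_act Q p (adj_inv (e \<one>))) = p"
  using adj_act_mult[of "adj_inv (e \<one>)" "e \<one>" p] by (simp del: adj_act_mult)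

lemma adj_act_a [simp]:
  assumes "x \<in> carrier M" "p \<in> carrier M"
  shows "adj_act Q p (a x) = p \<otimes> D x"
  using assms by (simp add: a_def T_adj_act_inv_e_one)

lemma adj_act_inv_a:
  assumes "x \<in> carrier M" "p \<in> carrier M"
  shows "adj_act Q p (adj_inv (a x)) = p \<otimes> inv (D x)"
proof -
  let ?q = "adj_act Q p (adj_inv (a x))"
  have "?q \<otimes> D x = p"
    using adj_act_mult[of "adj_inv (a x)" "a x" p] assms by (simp del: adj_act_mult)
  then show ?thesis
    using assms by (simp add: M.inv_solve_right)
qed

text \<open>Both \<open>a (x \<otimes> y)\<close> and \<open>a x \<cdot> a y\<close> have degree 0
  and translate by \<open>D (x \<otimes> y)\<close>, so their quotient has degree 0 and fixes
  \<open>\<one>\<close>.\<close>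

lemma c_closed [simp, intro]:
  assumes "x \<in> carrier M" "y \<in> carrier M"
  shows "c x y \<in> carrier \<pi>"
  using assms by (simp add: carrier_pi c_def adj_act_inv_a D.hom_mult[symmetric] M.m_assoc del: D.hom_mult pi_closed)

lemma a_mult: "\<lbrakk>x \<in> carrier M; y \<in> carrier M\<rbrakk> \<Longrightarrow> a x \<cdot> a y = a (x \<otimes> y) \<cdot> c x y"
  by (simp add: c_def)

text \<open>Both sides equal \<open>e (T x)\<close>, because \<open>e \<one>\<close> sends the point
  \<open>x\<close> to \<open>T x\<close>.\<close>

lemma a_e_one: "x \<in> carrier M \<Longrightarrow> a x \<cdot> e \<one> = e \<one> \<cdot> a (T x)"
  using Q.adj_gen_conj[of "e \<one>" x] by (simp add: a_def Q.A.m_assoc)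

text \<open>In \<open>a y \<cdot> a x\<close> the factor \<open>a x\<close> is pulled to the front
  past \<open>e y\<close> and the inverse of \<open>e \<one>\<close>. Being a translation by
  \<open>D x\<close>, it shifts both indices by \<open>D x\<close>. What remains is the inverse of
  \<open>a (D x)\<close> times \<open>a (D x \<otimes> y)\<close>, which is \<open>a y\<close> up to
  the inverse of \<open>c (D x) y\<close>.\<close>

lemma a_commute:
  assumes x: "x \<in> carrier M" and y: "y \<in> carrier M"
  shows "a x \<cdot> a y = a y \<cdot> a x \<cdot> c (D x) y"
proof -
  have "e \<one> \<cdot> a x = a x \<cdot> e (D x)" "e y \<cdot> a x = a x \<cdot> e (y \<otimes> D x)"
    using Q.adj_gen_conj[of "a x"] x y by auto
  \<comment> \<open>The first relation is multiplied by the inverse of \<open>e \<one>\<close> on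
    the left and of \<open>e (D x)\<close> on the right, so that the inverse of
    \<open>e \<one>\<close> can be moved past \<open>a x\<close>.\<close>
  then have "adj_inv (e \<one>) \<cdot> (e \<one> \<cdot> a x) \<cdot> adj_inv (e (D x)) = adj_inv (e \<one>) \<cdot> a x"
    and ya: "e y \<cdot> a x = a x \<cdot> e (y \<otimes> D x)"
    using x by (simp_all add: Q.A.m_assoc del: cancel_inv)
  then have ax: "adj_inv (e \<one>) \<cdot> a x = a x \<cdot> adj_inv (e (D x))"
    using x by simp
  have "a y \<cdot> a x = adj_inv (e \<one>) \<cdot> a x \<cdot> e (y \<otimes> D x)"
    using x y ya by (simp add: a_def[of y] Q.A.m_assoc)
  also have "\<dots> = a x \<cdot> (adj_inv (e (D x)) \<cdot> e (D x \<otimes> y))"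
    using x y by (simp add: ax Q.A.m_assoc M.m_comm)
  also have "adj_inv (e (D x)) \<cdot> e (D x \<otimes> y) = adj_inv (a (D x)) \<cdot> a (D x \<otimes> y)"
    using x y by (simp add: e_eq[of "D x"] e_eq[of "D x \<otimes> y"] Q.A.inv_mult_group Q.A.m_assoc)
  finally have "a y \<cdot> a x \<cdot> c (D x) y = a x \<cdot> (adj_inv (a (D x)) \<cdot> (a (D x \<otimes> y) \<cdot> c (D x) y))"
    using x y by (simp add: Q.A.m_assoc)
  also have "\<dots> = a x \<cdot> a y"
    using x y by (simp add: a_mult[symmetric])
  finally show ?thesis ..
qed

text \<open>Commutators with central values are multiplicative in the second argument: moving
  \<open>b\<close> past \<open>g\<close> and then past \<open>h\<close> leaves \<open>s\<close> and
  \<open>t\<close> behind, and centrality collects them on the right.\<close>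

lemma central_commutator_mult:
  assumes A: "b \<in> carrier (Adj Q)" "g \<in> carrier (Adj Q)" "h \<in> carrier (Adj Q)"
    and P: "s \<in> carrier \<pi>" "t \<in> carrier \<pi>"
    and s: "b \<cdot> g = g \<cdot> b \<cdot> s" and t: "b \<cdot> h = h \<cdot> b \<cdot> t"
  shows "b \<cdot> (g \<cdot> h) = g \<cdot> h \<cdot> b \<cdot> (s \<cdot> t)"
proof -
  note cl = A P[THEN pi_closed] Q.A.m_closed
  have "b \<cdot> (g \<cdot> h) = g \<cdot> b \<cdot> s \<cdot> h"
    by (simp only: s[symmetric] Q.A.m_assoc cl)
  also have "\<dots> = g \<cdot> b \<cdot> (h \<cdot> s)"
    by (simp only: pi_central[OF P(1) A(3)] Q.A.m_assoc cl)
  also have "\<dots> = g \<cdot> (b \<cdot> h) \<cdot> s"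
    by (simp only: Q.A.m_assoc cl)
  also have "\<dots> = g \<cdot> h \<cdot> b \<cdot> (t \<cdot> s)"
    unfolding t by (simp only: Q.A.m_assoc cl)
  also have "t \<cdot> s = s \<cdot> t"
    by (rule pi_central[OF P(1) pi_closed[OF P(2)]])
  finally show ?thesis .
qed

lemma central_commutator_mult_left:
  assumes A: "b \<in> carrier (Adj Q)" "b' \<in> carrier (Adj Q)" "g \<in> carrier (Adj Q)"
    and P: "s \<in> carrier \<pi>" "t \<in> carrier \<pi>"
    and s: "b \<cdot> g = g \<cdot> b \<cdot> s" and t: "b' \<cdot> g = g \<cdot> b' \<cdot> t"
  shows "b \<cdot> b' \<cdot> g = g \<cdot> (b \<cdot> b') \<cdot> (s \<cdot> t)"
proof -
  note cl = A P[THEN pi_closed] Q.A.m_closed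
  have "b \<cdot> b' \<cdot> g = b \<cdot> (b' \<cdot> g)"
    by (simp only: Q.A.m_assoc cl)
  also have "\<dots> = (b \<cdot> g) \<cdot> b' \<cdot> t"
    unfolding t by (simp only: Q.A.m_assoc cl)
  also have "\<dots> = g \<cdot> b \<cdot> (s \<cdot> b') \<cdot> t"
    unfolding s by (simp only: Q.A.m_assoc cl)
  also have "\<dots> = g \<cdot> (b \<cdot> b') \<cdot> (s \<cdot> t)"
    unfolding pi_central[OF P(1) A(2), symmetric] by (simp only: Q.A.m_assoc cl)
  finally show ?thesis .
qed

text \<open>By \<open>a_commute\<close>, \<open>c (D x)\<close> measures commutators with
  \<open>a x\<close>. The elements \<open>a (y \<otimes> z)\<close> and
  \<open>a y \<cdot> a z\<close> differ by the central factor \<open>c y z\<close>, so they have the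
  same commutator with \<open>a x\<close>.\<close>

lemma c_D_mult_right:
  assumes x: "x \<in> carrier M" and y: "y \<in> carrier M" and z: "z \<in> carrier M"
  shows "c (D x) (y \<otimes> z) = c (D x) y \<cdot> c (D x) z"
proof -
  let ?s = "c (D x) y \<cdot> c (D x) z" and ?k = "c y z" and ?g = "a (y \<otimes> z)"
  have s: "?s \<in> carrier \<pi>" using pi.m_closed[of "c (D x) y" "c (D x) z"] assms by simp
  have k: "?k \<in> carrier \<pi>" using assms by simp
  note cl = a_closed assms M.m_closed pi_closed[OF s] pi_closed[OF k] Q.A.m_closed
  have "a x \<cdot> ?g \<cdot> ?k = a x \<cdot> (?g \<cdot> ?k)"
    by (simp only: Q.A.m_assoc cl)
  also have "\<dots> = a x \<cdot> (a y \<cdot> a z)"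
    by (simp only: a_mult[OF y z])
  also have "\<dots> = a y \<cdot> a z \<cdot> a x \<cdot> ?s"
    by (rule central_commutator_mult[OF _ _ _ _ _ a_commute a_commute]) (use assms in simp_all)
  also have "\<dots> = ?g \<cdot> (?k \<cdot> a x) \<cdot> ?s"
    unfolding a_mult[OF y z] by (simp only: Q.A.m_assoc cl)
  also have "?k \<cdot> a x = a x \<cdot> ?k"
    by (rule pi_central[OF k, symmetric]) (simp add: x)
  also have "?g \<cdot> (a x \<cdot> ?k) \<cdot> ?s = ?g \<cdot> a x \<cdot> (?k \<cdot> ?s)"
    by (simp only: Q.A.m_assoc cl)
  also have "?k \<cdot> ?s = ?s \<cdot> ?k"
    by (rule pi_central[OF s pi_closed[OF k]])
  also have "?g \<cdot> a x \<cdot> (?s \<cdot> ?k) = ?g \<cdot> a x \<cdot> ?s \<cdot> ?k"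
    by (simp only: Q.A.m_assoc cl)
  finally have "a x \<cdot> ?g = ?g \<cdot> a x \<cdot> ?s"
    using assms k s by simp
  then have "?g \<cdot> a x \<cdot> c (D x) (y \<otimes> z) = ?g \<cdot> a x \<cdot> ?s"
    using a_commute[of x "y \<otimes> z"] assms by simp
  then show ?thesis
    using assms s by simp
qed

text \<open>The same argument in the first variable, with the central factor
  \<open>c x y\<close>.\<close>

lemma c_D_mult_left:
  assumes x: "x \<in> carrier M" and y: "y \<in> carrier M" and z: "z \<in> carrier M"
  shows "c (D (x \<otimes> y)) z = c (D x) z \<cdot> c (D y) z"
proof -
  let ?s = "c (D x) z \<cdot> c (D y) z" and ?k = "c x y" and ?b = "a (x \<otimes> y)"
  have s: "?s \<in> carrier \<pi>" using pi.m_closed[of "c (D x) z" "c (D y) z"] assms by simp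
  have k: "?k \<in> carrier \<pi>" using assms by simp
  note cl = a_closed assms M.m_closed pi_closed[OF s] pi_closed[OF k] Q.A.m_closed
  have "?b \<cdot> a z \<cdot> ?k = ?b \<cdot> (a z \<cdot> ?k)"
    by (simp only: Q.A.m_assoc cl)
  also have "a z \<cdot> ?k = ?k \<cdot> a z"
    by (rule pi_central[OF k]) (simp add: z)
  also have "?b \<cdot> (?k \<cdot> a z) = a x \<cdot> a y \<cdot> a z"
    unfolding a_mult[OF x y] by (simp only: Q.A.m_assoc cl)
  also have "\<dots> = a z \<cdot> (a x \<cdot> a y) \<cdot> ?s"
    by (rule central_commutator_mult_left[OF _ _ _ _ _ a_commute a_commute]) (use assms in simp_all)
  also have "\<dots> = a z \<cdot> ?b \<cdot> (?k \<cdot> ?s)"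
    unfolding a_mult[OF x y] by (simp only: Q.A.m_assoc cl)
  also have "?k \<cdot> ?s = ?s \<cdot> ?k"
    by (rule pi_central[OF s pi_closed[OF k]])
  also have "a z \<cdot> ?b \<cdot> (?s \<cdot> ?k) = a z \<cdot> ?b \<cdot> ?s \<cdot> ?k"
    by (simp only: Q.A.m_assoc cl)
  finally have "?b \<cdot> a z = a z \<cdot> ?b \<cdot> ?s"
    using assms k s by simp
  then have "a z \<cdot> ?b \<cdot> c (D (x \<otimes> y)) z = a z \<cdot> ?b \<cdot> ?s"
    using a_commute[of "x \<otimes> y" z] assms by simp
  then show ?thesis
    using assms s by (simp del: D.hom_mult)
qed

text \<open>The products \<open>a x \<cdot> a y\<close> and \<open>a y \<cdot> a x\<close> share the
  factor \<open>a (x \<otimes> y)\<close>; comparing what is left with \<open>a_commute\<close>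
  gives the antisymmetrization of \<open>c\<close>.\<close>

lemma c_eq_mult_D:
  assumes x: "x \<in> carrier M" and y: "y \<in> carrier M"
  shows "c x y = c y x \<cdot> c (D x) y"
proof -
  have "a (x \<otimes> y) \<cdot> c x y = a (x \<otimes> y) \<cdot> (c y x \<cdot> c (D x) y)"
    using a_commute[OF x y] a_mult[OF x y] a_mult[OF y x] x y by (simp add: Q.A.m_assoc M.m_comm)
  then show ?thesis using x y by simp
qed

sublocale pairing: twisted_pairing M T \<pi> c
proof
  \<comment> \<open>The formulas so far concern \<open>c (D x)\<close>; surjectivity of
    \<open>D\<close> frees the first argument.\<close>
  have D_surj: "\<exists>u\<in>carrier M. x = D u" if "x \<in> carrier M" for x
    using D_bij that by (auto simp: bij_betw_def)
  show left: "c (x \<otimes> x') y = c x y \<otimes>\<^bsub>\<pi>\<^esub> c x' y"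
    if "x \<in> carrier M" "x' \<in> carrier M" "y \<in> carrier M" for x x' y
    using D_surj[OF that(1)] D_surj[OF that(2)] c_D_mult_left that(3) by force
  show "c x (y \<otimes> y') = c x y \<otimes>\<^bsub>\<pi>\<^esub> c x y'"
    if "x \<in> carrier M" "y \<in> carrier M" "y' \<in> carrier M" for x y y'
    using D_surj[OF that(1)] c_D_mult_right that by force
  show "c (T y) x = c x y" if "x \<in> carrier M" "y \<in> carrier M" for x y
  proof -
    \<comment> \<open>Additivity is applied to y = D y + T y. Comparison with the formula for
      \<open>c y x\<close> in \<open>c_eq_mult_D\<close> cancels \<open>c (D y) x\<close> and leaves
      the twist.\<close>
    have "c y x = c (D y) x \<cdot> c (T y) x"
      using left[of "D y" "T y" x] that by (simp add: D_mult_T)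
    also have "\<dots> = c (T y) x \<cdot> c (D y) x"
      using that by (intro pi_central) auto
    finally have "c (T y) x \<cdot> c (D y) x = c x y \<cdot> c (D y) x"
      using c_eq_mult_D[OF that(2,1)] by simp
    then show ?thesis using that by simp
  qed
qed (auto intro: T_hom)

end

section \<open>The action on pairs\<close>

locale alexander_pairing = alexander M T + S: twisted_pairing M T S \<beta>
  for M :: "('a, 'b) monoid_scheme" (structure) and T and S :: "('c, 'd) monoid_scheme" and \<beta>
begin

text \<open>Right multiplication by \<open>(1, x, 0)\<close> in \<open>\<int> \<times> M \<times> S\<close> with the product
  \<open>(k, u, \<alpha>) (m, v, \<beta>) = (k + m, T\<^sup>m u + v, \<alpha> + \<beta> + [T\<^sup>m u \<otimes> v])\<close>; the first component is not needed
  because it is \<open>adj_eps\<close>.\<close>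

definition F where "F x = (\<lambda>(u, \<alpha>). (T u \<otimes> x, \<alpha> \<otimes>\<^bsub>S\<^esub> \<beta> (T u) x))"

abbreviation "X \<equiv> carrier M \<times> carrier S"

lemma F_bij_betw:
  assumes x: "x \<in> carrier M"
  shows "bij_betw (F x) X X"
  unfolding bij_betw_def
proof
  show "inj_on (F x) X"
    using x by (auto simp: inj_on_def F_def T_inj)
  show "F x ` X = X"
  proof
    show "F x ` X \<subseteq> X"
      using x by (auto simp: F_def)
    show "X \<subseteq> F x ` X"
    proof
      fix p assume "p \<in> X"
      then obtain v \<gamma> where p: "p = (v, \<gamma>)" "v \<in> carrier M" "\<gamma> \<in> carrier S"
        by auto
      then obtain u where u: "u \<in> carrier M" "T u = v \<otimes> inv x"
        using T_bij x by (metis M.inv_closed M.m_closed bij_betw_def imageE)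
      have "p = F x (u, \<gamma> \<otimes>\<^bsub>S\<^esub> inv\<^bsub>S\<^esub> \<beta> (T u) x)"
        using p u(1) x by (simp add: F_def S.H.m_assoc) (simp add: u(2) M.m_assoc)
      then show "p \<in> F x ` X"
        using p u(1) x by blast
    qed
  qed
qed

text \<open>With z standing for \<open>y \<star> x\<close>, everything comes from z + T x = T y + x.
  The first coordinates agree at once. In the second, the terms containing \<open>v\<close> and the
  terms free of it match separately.\<close>

lemma F_qop:
  assumes x: "x \<in> carrier M" and y: "y \<in> carrier M" and p: "p \<in> X"
  shows "F (y \<star>\<^bsub>Q\<^esub> x) (F x p) = F x (F y p)"
proof -
  obtain v \<alpha> where p: "p = (v, \<alpha>)" "v \<in> carrier M" "\<alpha> \<in> carrier S"
    using p by auto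
  define z where "z = y \<star>\<^bsub>Q\<^esub> x"
  have z: "z \<in> carrier M"
    using Q.qop_closed[of y x] x y by (simp add: z_def)
  have zx: "z \<otimes> T x = T y \<otimes> x"
    using x y by (simp add: z_def qop_Q M.m_assoc D_mult_T)
  define w where "w = T (T v)"
  have w: "w \<in> carrier M" using p(2) by (simp add: w_def)
  have bT: "\<beta> (T i) (T j) = \<beta> i j" if "i \<in> carrier M" "j \<in> carrier M" for i j
    using that by (simp add: S.c_twist)
  \<comment> \<open>\<open>zx\<close> is paired with \<open>w\<close> on the left; two twists turn
    \<open>\<beta> w (T j)\<close> into \<open>\<beta> (T v) j\<close>.\<close>
  have wz: "\<beta> (T v) x \<otimes>\<^bsub>S\<^esub> \<beta> w z = \<beta> (T v) y \<otimes>\<^bsub>S\<^esub> \<beta> w x"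
  proof -
    have "\<beta> w z \<otimes>\<^bsub>S\<^esub> \<beta> w (T x) = \<beta> w (T y) \<otimes>\<^bsub>S\<^esub> \<beta> w x"
      using S.c_mult_right[of w z "T x"] S.c_mult_right[of w "T y" x] zx x y z w by simp
    then show ?thesis
      using bT[of "T v"] x y z w p(2) by (simp add: w_def S.H.m_comm)
  qed
  \<comment> \<open>\<open>zx\<close> is paired with \<open>x\<close> on the right; the twist gives
    \<open>\<beta> (T x) x = \<beta> x x\<close>, which cancels.\<close>
  have xz: "\<beta> (T x) z = \<beta> (T y) x"
  proof -
    have "\<beta> z x \<otimes>\<^bsub>S\<^esub> \<beta> (T x) x = \<beta> (T y) x \<otimes>\<^bsub>S\<^esub> \<beta> x x"
      using S.c_mult_left[of z "T x" x] S.c_mult_left[of "T y" x x] zx x y z by simp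
    then show ?thesis
      using x y z by (simp add: S.c_twist)
  qed
  have first: "T (T v \<otimes> x) \<otimes> z = T (T v \<otimes> y) \<otimes> x"
    using zx x y z p(2) by (simp add: M.m_assoc M.m_comm[of "T x" z])
  have "\<beta> (T v) x \<otimes>\<^bsub>S\<^esub> \<beta> (T (T v \<otimes> x)) z = (\<beta> (T v) x \<otimes>\<^bsub>S\<^esub> \<beta> w z) \<otimes>\<^bsub>S\<^esub> \<beta> (T x) z"
    using x z p(2) by (simp add: w_def S.c_mult_left S.H.m_assoc)
  also have "\<dots> = \<beta> (T v) y \<otimes>\<^bsub>S\<^esub> \<beta> (T (T v \<otimes> y)) x"
    unfolding wz xz using x y p(2) by (simp add: w_def S.c_mult_left S.H.m_assoc)
  finally have second: "\<beta> (T v) x \<otimes>\<^bsub>S\<^esub> \<beta> (T (T v \<otimes> x)) z = \<beta> (T v) y \<otimes>\<^bsub>S\<^esub> \<beta> (T (T v \<otimes> y)) x" .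
  have "F z (F x p) = (T (T v \<otimes> x) \<otimes> z, \<alpha> \<otimes>\<^bsub>S\<^esub> (\<beta> (T v) x \<otimes>\<^bsub>S\<^esub> \<beta> (T (T v \<otimes> x)) z))"
    using x z p by (simp add: F_def S.H.m_assoc)
  also have "\<dots> = (T (T v \<otimes> y) \<otimes> x, \<alpha> \<otimes>\<^bsub>S\<^esub> (\<beta> (T v) y \<otimes>\<^bsub>S\<^esub> \<beta> (T (T v \<otimes> y)) x))"
    by (simp only: first second)
  also have "\<dots> = F x (F y p)"
    using x y p by (simp add: F_def S.H.m_assoc)
  finally show ?thesis by (simp add: z_def)
qed

sublocale R: adj_action Q X F
  by unfold_locales (simp_all add: F_bij_betw F_qop)

text \<open>The candidate for the inverse map. \<open>rho_hom\<close> shows that it is a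
  homomorphism on \<pi>_1, where the first coordinate of the base point stays fixed.\<close>

definition \<rho> where "\<rho> g = snd (R.act (\<one>, \<one>\<^bsub>S\<^esub>) g)"

text \<open>\<open>F x\<close> adds to the second coordinate an amount depending only on the first,
  so the action commutes with translations of the second coordinate.\<close>

lemma act_translate:
  assumes "g \<in> carrier (Adj Q)" "u \<in> carrier M" "\<alpha> \<in> carrier S" "\<gamma> \<in> carrier S"
  shows "R.act (u, \<alpha> \<otimes>\<^bsub>S\<^esub> \<gamma>) g = (fst (R.act (u, \<alpha>) g), snd (R.act (u, \<alpha>) g) \<otimes>\<^bsub>S\<^esub> \<gamma>)"
  using assms(1)
proof (induction rule: Adj_induct_iff)
  case one
  then show ?case using assms by simp
next
  case (mult g x)
  obtain v \<delta> where v: "R.act (u, \<alpha>) g = (v, \<delta>)" "v \<in> carrier M" "\<delta> \<in> carrier S"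
    using R.act_closed[OF mult(1), of "(u, \<alpha>)"] assms by force
  obtain w \<epsilon> where w: "R.act (u, \<alpha> \<otimes>\<^bsub>S\<^esub> \<gamma>) g = (w, \<epsilon>)" "w \<in> carrier M" "\<epsilon> \<in> carrier S"
    using R.act_closed[OF mult(1), of "(u, \<alpha> \<otimes>\<^bsub>S\<^esub> \<gamma>)"] assms by force
  have "F x (v, \<delta> \<otimes>\<^bsub>S\<^esub> \<gamma>) = (fst (F x (v, \<delta>)), snd (F x (v, \<delta>)) \<otimes>\<^bsub>S\<^esub> \<gamma>)"
    using mult(2) v assms by (simp add: F_def S.H.m_ac)
  \<comment> \<open>Injectivity of \<open>F x\<close> supplies the converse direction that
    \<open>Adj_induct_iff\<close> asks for.\<close>
  moreover have "F x (w, \<epsilon>) = F x (v, \<delta> \<otimes>\<^bsub>S\<^esub> \<gamma>) \<longleftrightarrow> (w, \<epsilon>) = (v, \<delta> \<otimes>\<^bsub>S\<^esub> \<gamma>)"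
    using inj_on_eq_iff[OF bij_betw_imp_inj_on[OF F_bij_betw]] mult(2) v w assms by simp
  ultimately show ?case
    using mult v w assms by (simp add: R.act_mult)
qed

text \<open>\<open>e \<one>\<close> adds \<open>\<beta> (T u) \<one>\<close>, which is trivial, so
  its inverse only undoes \<open>T\<close> on the first coordinate. Then \<open>e x\<close> restores
  \<open>u\<close> and contributes \<open>\<beta> u x\<close>.\<close>

lemma act_a:
  assumes "x \<in> carrier M" "u \<in> carrier M" "\<alpha> \<in> carrier S"
  shows "R.act (u, \<alpha>) (a x) = (u \<otimes> x, \<alpha> \<otimes>\<^bsub>S\<^esub> \<beta> u x)"
proof -
  obtain v where v: "v \<in> carrier M" "u = T v"
    using T_bij assms(2) by (auto simp: bij_betw_def)
  have "R.act (u, \<alpha>) (adj_inv (e \<one>)) = (v, \<alpha>)"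
    using R.act_inv_gen[of \<one> "(v, \<alpha>)"] v assms by (simp add: F_def)
  then show ?thesis
    using assms v by (simp add: a_def R.act_mult F_def)
qed

end

section \<open>Normal forms in the adjoint group and the inverse map\<close>

locale alexander_pairing_lift = alexander_pairing +
  fixes \<psi>
  assumes psi_hom: "\<psi> \<in> hom S \<pi>"
    and psi_beta: "\<lbrakk>x \<in> carrier M; y \<in> carrier M\<rbrakk> \<Longrightarrow> \<psi> (\<beta> x y) = c x y"
begin

sublocale psi: group_hom S \<pi> \<psi>
  by (intro group_homI S.H.is_group pi.is_group psi_hom)

text \<open>Coordinates on the adjoint group: degree, translation part and central part.\<close>

definition normal_form where
  "normal_form n = (\<lambda>(u, \<alpha>). e \<one> [^]\<^bsub>Adj Q\<^esub> (n :: int) \<cdot> a u \<cdot> \<psi> \<alpha>)"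

text \<open>\<open>e x\<close> passes the central factor as \<open>e \<one> \<cdot> a x\<close>;
  moving \<open>e \<one>\<close> to the left turns \<open>a u\<close> into \<open>a (T u)\<close>.
  Merging \<open>a (T u)\<close> with \<open>a x\<close> produces \<open>c (T u) x\<close>, the
  image under \<open>\<psi>\<close> of what \<open>F x\<close> adds.\<close>

lemma normal_form_mult_e:
  assumes p: "p \<in> X" and x: "x \<in> carrier M"
  shows "normal_form n p \<cdot> e x = normal_form (n + 1) (F x p)"
proof -
  obtain u \<alpha> where p: "p = (u, \<alpha>)" "u \<in> carrier M" "\<alpha> \<in> carrier S"
    using p by auto
  let ?z = "\<psi> \<alpha>" and ?n = "e \<one> [^]\<^bsub>Adj Q\<^esub> n" and ?c = "c (T u) x"
  have z: "?z \<in> carrier \<pi>" using p(3) by simp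
  have cc: "?c \<in> carrier \<pi>" using p x by simp
  have n: "?n \<in> carrier (Adj Q)" by simp
  note cl = a_closed e_closed[OF M.one_closed] T.hom_closed p(2) x M.m_closed pi_closed[OF z] pi_closed[OF cc] n Q.A.m_closed e_closed
  have "normal_form n p \<cdot> e x = ?n \<cdot> a u \<cdot> (?z \<cdot> e x)"
    unfolding normal_form_def p(1) prod.case by (simp only: Q.A.m_assoc cl)
  also have "?z \<cdot> e x = e \<one> \<cdot> a x \<cdot> ?z"
    using pi_central[OF z, of "e x"] x by (simp add: e_eq[OF x, symmetric])
  also have "?n \<cdot> a u \<cdot> (e \<one> \<cdot> a x \<cdot> ?z) = ?n \<cdot> (a u \<cdot> e \<one>) \<cdot> a x \<cdot> ?z"
    by (simp only: Q.A.m_assoc cl)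
  also have "a u \<cdot> e \<one> = e \<one> \<cdot> a (T u)"
    by (rule a_e_one[OF p(2)])
  also have "?n \<cdot> (e \<one> \<cdot> a (T u)) \<cdot> a x \<cdot> ?z = ?n \<cdot> e \<one> \<cdot> (a (T u) \<cdot> a x) \<cdot> ?z"
    by (simp only: Q.A.m_assoc cl)
  also have "a (T u) \<cdot> a x = a (T u \<otimes> x) \<cdot> ?c"
    using p x by (simp add: a_mult)
  also have "?n \<cdot> e \<one> \<cdot> (a (T u \<otimes> x) \<cdot> ?c) \<cdot> ?z = ?n \<cdot> e \<one> \<cdot> a (T u \<otimes> x) \<cdot> (?c \<cdot> ?z)"
    by (simp only: Q.A.m_assoc cl)
  also have "?c \<cdot> ?z = ?z \<cdot> ?c"
    by (rule pi_central[OF z pi_closed[OF cc]])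
  also have "?z \<cdot> ?c = \<psi> (\<alpha> \<otimes>\<^bsub>S\<^esub> \<beta> (T u) x)"
    using p x by (simp add: psi_beta)
  finally show ?thesis
    by (simp only: normal_form_def p(1) F_def prod.case e_one_pow_Suc)
qed

lemma normal_form_closed [simp, intro]: "p \<in> X \<Longrightarrow> normal_form n p \<in> carrier (Adj Q)"
  by (auto simp: normal_form_def)

text \<open>Both sides gain the same factor \<open>e x\<close> when g does, by
  \<open>normal_form_mult_e\<close>. Hence the degree of g and its effect on the base point
  determine g.\<close>

lemma eq_normal_form:
  assumes "g \<in> carrier (Adj Q)"
  shows "g = normal_form (adj_eps g) (R.act (\<one>, \<one>\<^bsub>S\<^esub>) g)"
  using assms
proof (induction rule: Adj_induct_iff)
  case one
  have "\<psi> \<one>\<^bsub>S\<^esub> = \<one>\<^bsub>Adj Q\<^esub>"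
    using psi.hom_one by (simp add: fundamental_group_def)
  then show ?case by (simp add: normal_form_def)
next
  case (mult g x)
  let ?p = "R.act (\<one>, \<one>\<^bsub>S\<^esub>) g"
  have p: "?p \<in> X" using mult by (intro R.act_closed) auto
  have "normal_form (adj_eps (g \<cdot> e x)) (R.act (\<one>, \<one>\<^bsub>S\<^esub>) (g \<cdot> e x)) = normal_form (adj_eps g) ?p \<cdot> e x"
    using mult p by (simp add: R.act_mult normal_form_mult_e)
  then show ?case
    using mult p by simp
qed

text \<open>In degree 0 the normal form of g is \<open>a u \<cdot> \<psi> \<alpha>\<close>. The
  central factor acts trivially on the quandle, so g moves \<open>\<one>\<close> to
  \<open>D u\<close>, and injectivity of \<open>D\<close> forces \<open>u = \<one>\<close>.\<close>

lemma act_pi: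
  assumes "g \<in> carrier \<pi>"
  shows "R.act (\<one>, \<one>\<^bsub>S\<^esub>) g = (\<one>, \<rho> g)" and "\<rho> g \<in> carrier S" and "\<psi> (\<rho> g) = g"
proof -
  obtain u \<alpha> where u: "R.act (\<one>, \<one>\<^bsub>S\<^esub>) g = (u, \<alpha>)" "u \<in> carrier M" "\<alpha> \<in> carrier S"
    using R.act_closed[OF pi_closed[OF assms], of "(\<one>, \<one>\<^bsub>S\<^esub>)"]
    by (cases "R.act (\<one>, \<one>\<^bsub>S\<^esub>) g") simp
  have z: "\<psi> \<alpha> \<in> carrier \<pi>" using u(3) by simp
  have g: "g = a u \<cdot> \<psi> \<alpha>"
    using eq_normal_form[of g] assms u by (simp add: normal_form_def carrier_pi del: pi_closed)
  then have "adj_act Q \<one> (a u \<cdot> \<psi> \<alpha>) = \<one>"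
    using assms by (simp add: carrier_pi del: adj_act_mult pi_closed)
  moreover have "adj_act Q (D u) (\<psi> \<alpha>) = D u"
    using adj_act_affine[of "\<psi> \<alpha>" "D u"] z u by (simp add: carrier_pi del: pi_closed)
  ultimately have "D u = \<one>"
    using u z by simp
  then have "u = \<one>" using u(2) D_eq_one by simp
  then show "R.act (\<one>, \<one>\<^bsub>S\<^esub>) g = (\<one>, \<rho> g)" "\<rho> g \<in> carrier S" "\<psi> (\<rho> g) = g"
    using u g z by (simp_all add: \<rho>_def)
qed

text \<open>After g the base point has only been translated in its second coordinate by
  \<open>\<rho> g\<close>, and by \<open>act_translate\<close> this commutes with the action of
  h.\<close>

lemma rho_hom: "\<rho> \<in> hom \<pi> S"
proof (rule homI)
  show "\<rho> g \<in> carrier S" if "g \<in> carrier \<pi>" for g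
    using that by (rule act_pi)
  fix g h assume g: "g \<in> carrier \<pi>" and h: "h \<in> carrier \<pi>"
  have "R.act (\<one>, \<one>\<^bsub>S\<^esub>) (g \<cdot> h) = R.act (\<one>, \<one>\<^bsub>S\<^esub> \<otimes>\<^bsub>S\<^esub> \<rho> g) h"
    using g h act_pi by (simp add: R.act_mult)
  also have "\<dots> = (\<one>, \<rho> h \<otimes>\<^bsub>S\<^esub> \<rho> g)"
    using act_translate[of h \<one> "\<one>\<^bsub>S\<^esub>" "\<rho> g"] g h act_pi by simp
  finally show "\<rho> (g \<otimes>\<^bsub>\<pi>\<^esub> h) = \<rho> g \<otimes>\<^bsub>S\<^esub> \<rho> h"
    using g h act_pi by (simp add: \<rho>_def[of "g \<cdot> h"] S.H.m_comm)
qed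

text \<open>The base point is moved by \<open>a x \<cdot> a y\<close> in two ways: two uses of
  \<open>act_a\<close> contribute \<open>\<beta> x y\<close>, while the factorization into
  \<open>c x y\<close> and \<open>a (x \<otimes> y)\<close> contributes
  \<open>\<rho> (c x y)\<close>.\<close>

lemma rho_c:
  assumes x: "x \<in> carrier M" and y: "y \<in> carrier M"
  shows "\<rho> (c x y) = \<beta> x y"
proof -
  let ?r = "\<rho> (c x y)"
  have c: "c x y \<in> carrier \<pi>" using assms by simp
  have r: "?r \<in> carrier S" using act_pi[OF c] by simp
  have "a x \<cdot> a y = c x y \<cdot> a (x \<otimes> y)"
    using pi_central[OF c, of "a (x \<otimes> y)"] x y by (simp add: a_mult)
  then have "R.act (\<one>, \<one>\<^bsub>S\<^esub>) (a x \<cdot> a y) = R.act (\<one>, ?r) (a (x \<otimes> y))"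
    using x y act_pi[OF c] by (simp add: R.act_mult)
  also have "\<dots> = (x \<otimes> y, ?r)"
    using x y r by (simp add: act_a)
  finally show ?thesis
    using x y by (simp add: R.act_mult act_a)
qed

end

theorem mainTheorem2:
  fixes M :: "('a, 'b) monoid_scheme" and T :: "'a \<Rightarrow> 'a"
  assumes "comm_group M"
    and "T \<in> iso M M"
    and "(\<lambda>x. x \<otimes>\<^bsub>M\<^esub> inv\<^bsub>M\<^esub> (T x)) \<in> iso M M"
  shows "fundamental_group (alexander_quandle M T) \<one>\<^bsub>M\<^esub> \<cong> S_group M T"
proof -
  interpret alexander M T
    using assms by (simp add: alexander_def alexander_axioms_def)
  obtain \<psi> where psi: "\<psi> \<in> hom (S_group M T) \<pi>"
    "\<And>x y. \<lbrakk>x \<in> carrier M; y \<in> carrier M\<rbrakk> \<Longrightarrow> \<psi> (S_class M T x y) = c x y"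
    using pairing.S_group_universal by blast
  interpret S: twisted_pairing M T "S_group M T" "S_class M T"
    by (rule twisted_pairing_S_class[OF assms(1) T_hom])
  interpret alexander_pairing_lift M T "S_group M T" "S_class M T" \<psi>
    by unfold_locales (fact psi)+
  \<comment> \<open>That \<open>\<psi>\<close> after \<open>\<rho>\<close> is the identity is part
    of \<open>act_pi\<close>. The other composite is compared with the identity on classes of pure
    tensors, by \<open>psi_beta\<close> and \<open>rho_c\<close>.\<close>
  have rho_psi: "\<rho> (\<psi> s) = s" if "s \<in> carrier (S_group M T)" for s
  proof -
    have "(\<rho> \<circ> \<psi>) s = id s"
    proof (rule S_group_hom_unique[OF assms(1) T_hom S.H.is_group _ _ _ that])
      show "\<rho> \<circ> \<psi> \<in> hom (S_group M T) (S_group M T)"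
        by (rule hom_compose[OF psi(1) rho_hom])
      show "id \<in> hom (S_group M T) (S_group M T)"
        by (simp add: hom_def)
    qed (simp add: psi_beta rho_c)
    then show ?thesis by simp
  qed
  have "bij_betw \<rho> (carrier \<pi>) (carrier (S_group M T))"
    by (rule bij_betw_byWitness[where f' = \<psi>]) (use act_pi rho_psi psi.hom_closed in auto)
  then show ?thesis
    using rho_hom unfolding is_iso_def iso_def by blast
qed

end
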